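(* For any positive integer $r$ and any complex numbers $z,t$, we have $$\sum_{\lambda} q^{|\lambda|}\prod_{h\in\mathcal{H}_r(\lambda)}\left(1-\frac{\sin^2(tz)}{\sin^2(hz)}\right)=\exp\sum_{k=1}^{\infty}\left(\frac{q^k}{k(1-q^k)}-\frac{r\,q^{rk}}{k(1-q^{rk})}\,\frac{\sin^2(tkz)}{\sin^2(rkz)}\right),$$ where the sum on the left is over all integer partitions $\lambda$.
   Context: Here $q$ is the variable of the generating series. Partitions include the empty partition; $|\lambda|$ is the size of $\lambda$, $\mathcal{H}(\lambda)$ is the multiset of hook lengths of all boxes of the Ferrers diagram of $\lambda$, and $\mathcal{H}_r(\lambda)$ is the sub-multiset of those hook lengths divisible by $r$.
   Formalization: The identity is stated for complex z with sin(rkz) ≠ 0 for every k ≥ 1 (z not a rational multiple of π), since otherwise denominators on both sides vanish and the formula is undefined; t is arbitrary. *)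

theory Defs
  imports
    "HOL-Library.Multiset"
    "HOL-Computational_Algebra.Formal_Power_Series"
    "HOL-Analysis.Infinite_Sum"
begin

text \<open>
  A partition is the weakly decreasing list of its positive parts; the empty partition is the
  empty list, and the size of a partition is \<^const>\<open>sum_list\<close>.
\<close>

definition partitions :: "nat list set" where
  "partitions = {xs. sorted_wrt (\<ge>) xs \<and> 0 \<notin> set xs}"

definition ferrers :: "nat list \<Rightarrow> (nat \<times> nat) set" where
  "ferrers xs = {(i, j). i < length xs \<and> j < xs ! i}"

text \<open>Boxes are (row, column) with both coordinates counted from 0. The hook contains its corner.\<close>

definition hook :: "nat list \<Rightarrow> nat \<times> nat \<Rightarrow> (nat \<times> nat) set" where
  "hook xs b = {c \<in> ferrers xs.
     (fst c = fst b \<and> snd c \<ge> snd b) \<or> (snd c = snd b \<and> fst c \<ge> fst b)}"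

definition hook_lengths :: "nat list \<Rightarrow> nat multiset" where
  "hook_lengths xs = image_mset (\<lambda>b. card (hook xs b)) (mset_set (ferrers xs))"

definition hook_lengths_dvd :: "nat \<Rightarrow> nat list \<Rightarrow> nat multiset" where
  "hook_lengths_dvd r xs = filter_mset (\<lambda>h. r dvd h) (hook_lengths xs)"

text \<open>
  The series in the variable \<open>q\<close> are formal, so sums converge in the \<open>fps_X\<close>-adic topology of
  \<^typ>\<open>complex fps\<close>. The exponential of a series without constant term is obtained by
  composition. All denominators below have nonzero constant coefficient for \<open>k \<ge> 1\<close>.
\<close>

abbreviation fps_exponential :: "complex fps \<Rightarrow> complex fps" where
  "fps_exponential f \<equiv> fps_exp 1 oo f"

definition log_term :: "nat \<Rightarrow> complex \<Rightarrow> complex \<Rightarrow> nat \<Rightarrow> complex fps" where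
  "log_term r z t k =
     fps_X ^ k / (of_nat k * (1 - fps_X ^ k))
     - of_nat r * fps_X ^ (r * k) / (of_nat k * (1 - fps_X ^ (r * k)))
       * fps_const ((sin (t * of_nat k * z))\<^sup>2 / (sin (of_nat r * of_nat k * z))\<^sup>2)"

end

theory Submission
  imports Defs
    "Jordan_Normal_Form.Determinant"
    "HOL-Computational_Algebra.Polynomial_FPS"
    "HOL-Analysis.Continuum_Not_Denumerable"
    "HOL-Analysis.Complex_Transcendental"
begin

text \<open>
  Put \<open>p = exp(2irz)\<close> and \<open>u = exp(2itz)\<close>. The factor of a hook of length \<open>rh\<close> is
  \<open>(1 - u p^h)(1 - p^h/u) / (1 - p^h)^2\<close>, and the coefficients of both sides are Laurent
  polynomials in \<open>u\<close>, so it suffices to treat \<open>u = p^n\<close>.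

  Encode a partition with at most \<open>N\<close> parts by the set \<open>B\<close> of its \<open>N\<close> beta numbers. The weight of
  the partition is then the principal minor on \<open>B\<close> of the product of a lower and an upper triangular
  Toeplitz matrix with symbols \<open>\<Prod>(1 - p^i w^r)^-1\<close> and \<open>\<Prod>(1 - p^-j w^-r)\<close> (\<open>i, j < n\<close>): the
  \<open>q\<close>-binomial theorem turns this product into a Cauchy matrix, whose minors factor. The left hand
  side is therefore, up to a power of \<open>q\<close> and high order terms, the sum of all \<open>N\<close>-rowed principal
  minors of \<open>q^L T_X T_Y\<close>, where \<open>L = diag(0, 1, 2, \<dots>)\<close>. That sum is invariant under cyclic
  permutation of the factors, and moving a factor \<open>1 + y w^-r\<close> past \<open>q^L\<close> replaces \<open>y\<close> by
  \<open>y q^r\<close>, while moving it past \<open>T_X\<close> costs only column operations of determinant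
  \<open>\<Prod>(1 + y p^i)^r\<close>. Rotating forever gives the product \<open>\<Prod>(1 - p^(i-j) q^(rs))^r\<close> times the
  generating function of all partitions, which matches the right hand side by comparing logarithmic
  derivatives.
\<close>

section \<open>Principal minors\<close>

text \<open>The Leibniz formula over permutations of the index set itself, so that finite principal
  minors of an infinite matrix need no renumbering.\<close>

definition minor :: "nat set \<Rightarrow> (nat \<Rightarrow> nat \<Rightarrow> 'a::comm_ring_1) \<Rightarrow> 'a" where
  "minor B M = (\<Sum>\<pi> | \<pi> permutes B. of_int (sign \<pi>) * (\<Prod>j\<in>B. M (\<pi> j) j))"

lemma minor_cong:
  assumes "\<And>i j. i \<in> B \<Longrightarrow> j \<in> B \<Longrightarrow> M i j = M' i j"
  shows "minor B M = minor B M'"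
  unfolding minor_def
  by (intro sum.cong refl arg_cong2[where f = "(*)"] prod.cong assms)
    (auto simp: permutes_in_image)

lemma minor_scale:
  "minor B (\<lambda>i j. a i * M i j * b j) = prod a B * prod b B * minor B M"
proof -
  have "(\<Prod>j\<in>B. a (\<pi> j) * M (\<pi> j) j * b j) = prod a B * prod b B * (\<Prod>j\<in>B. M (\<pi> j) j)"
    if "\<pi> permutes B" for \<pi>
    using prod.permute[OF that, of a] by (simp add: prod.distrib o_def mult_ac)
  then show ?thesis
    by (auto simp: minor_def sum_distrib_left mult_ac intro!: sum.cong)
qed

text \<open>Composing with the transposition of the two columns flips every sign and keeps every
  product, so the minor is its own negative; characteristic zero cancels the factor 2.\<close>

lemma minor_equal_columns:
  fixes M :: "nat \<Rightarrow> nat \<Rightarrow> 'a::{idom,semiring_char_0}"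
  assumes B: "finite B" "k \<in> B" "l \<in> B" "k \<noteq> l" and eq: "\<And>i. i \<in> B \<Longrightarrow> M i k = M i l"
  shows "minor B M = 0"
proof -
  let ?t = "Transposition.transpose k l"
  have t: "?t permutes B" using B by (simp add: permutes_swap_id)
  have "minor B M = (\<Sum>\<pi> | \<pi> permutes B. of_int (sign (\<pi> \<circ> ?t)) * (\<Prod>j\<in>B. M ((\<pi> \<circ> ?t) j) j))"
    unfolding minor_def
    by (rule sum.reindex_bij_witness[of _ "\<lambda>\<pi>. \<pi> \<circ> ?t" "\<lambda>\<pi>. \<pi> \<circ> ?t"])
      (auto simp: t permutes_compose o_assoc[symmetric])
  also have "\<dots> = (\<Sum>\<pi> | \<pi> permutes B. - (of_int (sign \<pi>) * (\<Prod>j\<in>B. M (\<pi> j) j)))"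
  proof (intro sum.cong refl)
    fix \<pi> assume "\<pi> \<in> {\<pi>. \<pi> permutes B}"
    then have \<pi>: "\<pi> permutes B" by simp
    have "sign (\<pi> \<circ> ?t) = - sign \<pi>"
      using \<pi> t B by (subst sign_compose) (auto simp: permutation_permutes sign_swap_id)
    moreover have "(\<Prod>j\<in>B. M ((\<pi> \<circ> ?t) j) j) = (\<Prod>j\<in>B. M (\<pi> j) j)"
    proof -
      have "(\<Prod>j\<in>B. M (\<pi> j) j) = (\<Prod>j\<in>B. M (\<pi> (?t j)) (?t j))"
        using prod.permute[OF t, of "\<lambda>j. M (\<pi> j) j"] by (simp add: o_def)
      also have "\<dots> = (\<Prod>j\<in>B. M ((\<pi> \<circ> ?t) j) j)"
        using eq B \<pi> by (intro prod.cong refl) (auto simp: Transposition.transpose_def permutes_in_image)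
      finally show ?thesis by simp
    qed
    ultimately show "of_int (sign (\<pi> \<circ> ?t)) * (\<Prod>j\<in>B. M ((\<pi> \<circ> ?t) j) j) =
      - (of_int (sign \<pi>) * (\<Prod>j\<in>B. M (\<pi> j) j))" by simp
  qed
  also have "\<dots> = - minor B M" by (simp add: minor_def sum_negf)
  finally have "2 * minor B M = 0" by simp
  then show ?thesis by simp
qed

lemma minor_column_linear:
  assumes "finite B" "k \<in> B"
  shows "minor B (\<lambda>i j. if j = k then \<Sum>l\<in>I. c l * f l i else M i j) =
    (\<Sum>l\<in>I. c l * minor B (\<lambda>i j. if j = k then f l i else M i j))"
proof -
  have "(\<Prod>j\<in>B. if j = k then h (\<pi> j) else M (\<pi> j) j) = h (\<pi> k) * (\<Prod>j\<in>B - {k}. M (\<pi> j) j)"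
    for h :: "nat \<Rightarrow> 'a" and \<pi>
    using assms by (subst prod.remove[of _ k]) (auto intro!: prod.cong)
  note expand = this
  show ?thesis
    unfolding minor_def expand[where h = "\<lambda>i. \<Sum>l\<in>I. c l * f l i"] expand[where h = "f l" for l]
    by (simp add: sum_distrib_left sum_distrib_right mult_ac) (rule sum.swap)
qed

text \<open>Expand each changed column multilinearly: terms taken from \<open>S\<close> repeat a
  column, since \<open>S\<close> is disjoint from \<open>J\<close> and its columns are never
  altered. Only the factors \<open>c\<close> survive.\<close>

lemma minor_column_combination:
  fixes M :: "nat \<Rightarrow> nat \<Rightarrow> 'a::{idom,semiring_char_0}"
  assumes B: "finite B" "J \<subseteq> B" "S \<subseteq> B" "J \<inter> S = {}"
  shows "minor B (\<lambda>i j. if j \<in> J then c * M i j + (\<Sum>k\<in>S. w j k * M i k) else M i j) =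
    c ^ card J * minor B M"
proof -
  have fin: "finite J" "finite S" using B finite_subset by blast+
  from fin(1) B(2,4) show ?thesis
  proof (induction J)
    case empty
    then show ?case by simp
  next
    case (insert x J)
    define M' where "M' = (\<lambda>i j. if j \<in> J then c * M i j + (\<Sum>k\<in>S. w j k * M i k) else M i j)"
    \<comment> \<open>\<open>None\<close> indexes the old column \<open>x\<close>,
      \<open>Some k\<close> the column \<open>k\<close> of \<open>S\<close>; the new column becomes
      a single sum, as \<open>minor_column_linear\<close> expects.\<close>
    define col where "col = (\<lambda>l i. case l of None \<Rightarrow> M i x | Some k \<Rightarrow> M i k)"
    define cf where "cf = (\<lambda>l. case l of None \<Rightarrow> c | Some k \<Rightarrow> w x k)"
    have "minor B (\<lambda>i j. if j \<in> insert x J then c * M i j + (\<Sum>k\<in>S. w j k * M i k) else M i j) =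
      minor B (\<lambda>i j. if j = x then \<Sum>l\<in>insert None (Some ` S). cf l * col l i else M' i j)"
      using insert.hyps fin
      by (intro arg_cong[where f = "minor B"])
        (auto simp: fun_eq_iff M'_def col_def cf_def sum.reindex)
    also have "\<dots> =
      (\<Sum>l\<in>insert None (Some ` S). cf l * minor B (\<lambda>i j. if j = x then col l i else M' i j))"
      using B insert.prems by (intro minor_column_linear) auto
    also have "\<dots> = c * minor B (\<lambda>i j. if j = x then M i x else M' i j) +
      (\<Sum>k\<in>S. w x k * minor B (\<lambda>i j. if j = x then M i k else M' i j))"
      using fin by (simp add: cf_def col_def sum.reindex cong: if_cong)
    also have "(\<Sum>k\<in>S. w x k * minor B (\<lambda>i j. if j = x then M i k else M' i j)) = 0"
    proof (intro sum.neutral ballI)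
      fix k assume "k \<in> S"
      then have "minor B (\<lambda>i j. if j = x then M i k else M' i j) = 0"
        using insert.prems B by (intro minor_equal_columns[of _ x k]) (auto simp: M'_def)
      then show "w x k * minor B (\<lambda>i j. if j = x then M i k else M' i j) = 0" by simp
    qed
    also have "(\<lambda>i j. if j = x then M i x else M' i j) = M'"
      using insert.hyps by (auto simp: M'_def fun_eq_iff)
    also have "minor B M' = c ^ card J * minor B M"
      unfolding M'_def using insert.IH insert.prems by simp
    finally show ?case using insert.hyps by simp
  qed
qed

text \<open>One step of Schur complementation: \<open>w j\<close> is the multiple of column
  \<open>s\<close> that clears row \<open>s\<close> in column \<open>j\<close>. Stating it with
  \<open>w\<close> avoids division in the ring.\<close>

lemma minor_insert:
  fixes M :: "nat \<Rightarrow> nat \<Rightarrow> 'a::{idom,semiring_char_0}"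
  assumes B: "finite B" "s \<notin> B" and w: "\<And>j. j \<in> B \<Longrightarrow> M s j = w j * M s s"
  shows "minor (insert s B) M = M s s * minor B (\<lambda>i j. M i j - w j * M i s)"
proof -
  define M' where "M' = (\<lambda>i j. if j \<in> B then 1 * M i j + (\<Sum>k\<in>{s}. - w j * M i k) else M i j)"
  have "minor (insert s B) M = minor (insert s B) M'"
    unfolding M'_def
    using B by (subst minor_column_combination) auto
  also have "\<dots> = (\<Sum>\<pi> | \<pi> permutes B. of_int (sign \<pi>) * (\<Prod>j\<in>insert s B. M' (\<pi> j) j))"
    unfolding minor_def
  proof (rule sum.mono_neutral_right)
    show "finite {\<pi>. \<pi> permutes insert s B}" using B by (simp add: finite_permutations)
    show "{\<pi>. \<pi> permutes B} \<subseteq> {\<pi>. \<pi> permutes insert s B}"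
      by (auto intro: permutes_subset)
    show "\<forall>\<pi>\<in>{\<pi>. \<pi> permutes insert s B} - {\<pi>. \<pi> permutes B}.
        of_int (sign \<pi>) * (\<Prod>j\<in>insert s B. M' (\<pi> j) j) = 0"
    proof
      fix \<pi> assume "\<pi> \<in> {\<pi>. \<pi> permutes insert s B} - {\<pi>. \<pi> permutes B}"
      then have \<pi>: "\<pi> permutes insert s B" "\<not> \<pi> permutes B" by auto
      \<comment> \<open>A permutation of \<open>insert s B\<close> that is not one of
        \<open>B\<close> moves \<open>s\<close>, hence picks an entry of row \<open>s\<close> in a
        column of \<open>B\<close>, and these have been cleared.\<close>
      have "\<pi> s \<noteq> s"
        using \<pi> permutes_superset[of \<pi> "insert s B" B] by auto
      obtain j where j: "j \<in> insert s B" "\<pi> j = s"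
        using \<pi>(1) by (metis insertI1 permutes_image imageE)
      with \<open>\<pi> s \<noteq> s\<close> have "j \<in> B" by auto
      then have "M' (\<pi> j) j = 0" using j w by (simp add: M'_def)
      then have "(\<Prod>j\<in>insert s B. M' (\<pi> j) j) = 0"
        using B j by (meson finite_insert prod_zero)
      then show "of_int (sign \<pi>) * (\<Prod>j\<in>insert s B. M' (\<pi> j) j) = 0" by simp
    qed
  qed
  also have "\<dots> = M' s s * minor B M'"
    using B by (simp add: minor_def sum_distrib_left mult_ac permutes_not_in)
  also have "M' s s = M s s" using B by (simp add: M'_def)
  also have "minor B M' = minor B (\<lambda>i j. M i j - w j * M i s)"
    by (rule minor_cong) (simp add: M'_def)
  finally show ?thesis .
qed

section \<open>Determinants of products and sums of principal minors\<close>

lemma minor_eq_det: "minor {..<d} M = Determinant.det (Matrix.mat d d (\<lambda>(i, j). M i j))"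
proof -
  have "Determinant.det (Matrix.mat d d (\<lambda>(i, j). M i j)) = Determinant.det (transpose_mat (Matrix.mat d d (\<lambda>(i, j). M i j)))"
    by (rule det_transpose[symmetric]) auto
  also have "transpose_mat (Matrix.mat d d (\<lambda>(i, j). M i j)) = Matrix.mat d d (\<lambda>(i, j). M j i)"
    by auto
  also have "Determinant.det \<dots> = minor {..<d} M"
    unfolding minor_def
    by (subst det_def'[of _ d])
      (auto simp: lessThan_atLeast0 permutes_in_image intro!: sum.cong prod.cong)
  finally show ?thesis by simp
qed

lemma minor_mult:
  "minor {..<d} A * minor {..<d} C = minor {..<d} (\<lambda>i j. \<Sum>l<d. A i l * C l j)"
proof -
  have "Matrix.mat d d (\<lambda>(i, j). A i j) * Matrix.mat d d (\<lambda>(i, j). C i j) =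
      Matrix.mat d d (\<lambda>(i, j). \<Sum>l<d. A i l * C l j)"
    by (auto simp: scalar_prod_def lessThan_atLeast0 intro!: eq_matI sum.cong)
  then show ?thesis
    by (simp add: minor_eq_det flip: det_mult[of _ d])
qed

lemma minor_upper_unitriangular:
  assumes "\<And>i. i < d \<Longrightarrow> M i i = 1" "\<And>i j. j < i \<Longrightarrow> M i j = 0"
  shows "minor {..<d} M = 1"
  unfolding minor_eq_det
  by (subst det_upper_triangular[of _ d])
    (auto simp: upper_triangular_def assms prod_list_diag_prod)

text \<open>Multiply out over the columns: \<open>B\<close> collects those where the term with
  \<open>A\<close> is chosen, and the Kronecker deltas elsewhere force the permutation to fix the
  rest. Sums of principal minors thus become coefficients of a determinant.\<close>

lemma minor_one_plus:
  "minor {..<d} (\<lambda>i j. z * A i j + of_bool (i = j)) = (\<Sum>B\<in>Pow {..<d}. z ^ card B * minor B A)"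
proof -
  have "minor {..<d} (\<lambda>i j. z * A i j + of_bool (i = j)) =
    (\<Sum>\<pi> | \<pi> permutes {..<d}. \<Sum>B\<in>Pow {..<d}. z ^ card B * (of_int (sign \<pi>) *
      ((\<Prod>j\<in>B. A (\<pi> j) j) * (\<Prod>j\<in>{..<d} - B. of_bool (\<pi> j = j)))))"
    unfolding minor_def
    by (simp add: prod_add sum_distrib_left prod.distrib mult_ac)
  also have "\<dots> = (\<Sum>B\<in>Pow {..<d}. z ^ card B * (\<Sum>\<pi> | \<pi> permutes {..<d}. of_int (sign \<pi>) *
      ((\<Prod>j\<in>B. A (\<pi> j) j) * (\<Prod>j\<in>{..<d} - B. of_bool (\<pi> j = j)))))"
    by (subst sum.swap) (simp add: sum_distrib_left)
  also have "\<dots> = (\<Sum>B\<in>Pow {..<d}. z ^ card B * minor B A)"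
  proof (intro sum.cong refl arg_cong2[where f = "(*)"])
    fix B assume B: "B \<in> Pow {..<d}"
    have "(\<Sum>\<pi> | \<pi> permutes {..<d}. of_int (sign \<pi>) *
      ((\<Prod>j\<in>B. A (\<pi> j) j) * (\<Prod>j\<in>{..<d} - B. of_bool (\<pi> j = j)))) =
      (\<Sum>\<pi> | \<pi> permutes B. of_int (sign \<pi>) *
      ((\<Prod>j\<in>B. A (\<pi> j) j) * (\<Prod>j\<in>{..<d} - B. of_bool (\<pi> j = j))))"
    proof (rule sum.mono_neutral_right)
      show "finite {\<pi>. \<pi> permutes {..<d}}" by (simp add: finite_permutations)
      show "{\<pi>. \<pi> permutes B} \<subseteq> {\<pi>. \<pi> permutes {..<d}}"
        using B by (auto intro: permutes_subset)
      show "\<forall>\<pi>\<in>{\<pi>. \<pi> permutes {..<d}} - {\<pi>. \<pi> permutes B}. of_int (sign \<pi>) *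
        ((\<Prod>j\<in>B. A (\<pi> j) j) * (\<Prod>j\<in>{..<d} - B. of_bool (\<pi> j = j))) = 0"
      proof
        fix \<pi> assume "\<pi> \<in> {\<pi>. \<pi> permutes {..<d}} - {\<pi>. \<pi> permutes B}"
        then obtain j where "j \<in> {..<d} - B" "\<pi> j \<noteq> j"
          using permutes_superset[of \<pi> "{..<d}" B] by auto
        then have "(\<Prod>j\<in>{..<d} - B. of_bool (\<pi> j = j)) = (0::'a)"
          by (intro prod_zero) auto
        then show "of_int (sign \<pi>) *
          ((\<Prod>j\<in>B. A (\<pi> j) j) * (\<Prod>j\<in>{..<d} - B. of_bool (\<pi> j = j))) = 0" by simp
      qed
    qed
    also have "\<dots> = minor B A"
      unfolding minor_def by (intro sum.cong refl) (simp add: permutes_not_in)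
    finally show "(\<Sum>\<pi> | \<pi> permutes {..<d}. of_int (sign \<pi>) *
      ((\<Prod>j\<in>B. A (\<pi> j) j) * (\<Prod>j\<in>{..<d} - B. of_bool (\<pi> j = j)))) = minor B A" .
  qed
  finally show ?thesis .
qed

lemma sum_const_poly: "[:\<Sum>k\<in>S. f k:] = (\<Sum>k\<in>S. [:f k:])"
  by (rule poly_eqI) (simp add: coeff_sum coeff_pCons split: nat.split)

lemma minor_const_poly: "minor B (\<lambda>i j. [:A i j:]) = [:minor B A:]"
proof -
  have 1: "(\<Prod>j\<in>B. [:f j:]) = [:\<Prod>j\<in>B. f j:]" for f :: "nat \<Rightarrow> 'a"
    by (induction B rule: infinite_finite_induct) (auto simp: mult.commute)
  have 2: "of_int k = [:of_int k :: 'a:]" for k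
    by (metis of_int_poly)
  show ?thesis
    unfolding minor_def 1 2 by (simp add: sum_const_poly mult.commute)
qed

text \<open>The sums are the coefficients of \<open>z^N\<close> in det(1 + z AT) and det(1 + z TA).
  From T (1 + z AT) = (1 + z TA) T and det T = 1 the two determinants agree.\<close>

lemma sum_minors_cyclic:
  fixes A T :: "nat \<Rightarrow> nat \<Rightarrow> 'a::idom"
  assumes T: "minor {..<d} T = 1"
  shows "(\<Sum>B | B \<subseteq> {..<d} \<and> card B = N. minor B (\<lambda>i j. \<Sum>l<d. A i l * T l j)) =
    (\<Sum>B | B \<subseteq> {..<d} \<and> card B = N. minor B (\<lambda>i j. \<Sum>l<d. T i l * A l j))"
proof -
  let ?z = "[:0, 1:] :: 'a poly"
  let ?AT = "\<lambda>i j. \<Sum>l<d. A i l * T l j" and ?TA = "\<lambda>i j. \<Sum>l<d. T i l * A l j"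
  define P where "P = (\<lambda>C. minor {..<d} (\<lambda>i j. ?z * [:C i j:] + of_bool (i = j)))"
  have coeff: "coeff (P C) N = (\<Sum>B | B \<subseteq> {..<d} \<and> card B = N. minor B C)" for C
  proof -
    have "P C = (\<Sum>B\<in>Pow {..<d}. ?z ^ card B * [:minor B C:])"
      unfolding P_def minor_one_plus minor_const_poly ..
    also have "\<dots> = (\<Sum>B\<in>Pow {..<d}. monom (minor B C) (card B))"
      by (intro sum.cong refl) (simp add: monom_altdef)
    also have "coeff \<dots> N = (\<Sum>B\<in>Pow {..<d}. if card B = N then minor B C else 0)"
      by (simp add: coeff_sum)
    also have "\<dots> = (\<Sum>B | B \<subseteq> {..<d} \<and> card B = N. minor B C)"
      by (subst sum.inter_filter[symmetric]) (auto intro!: sum.cong)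
    finally show ?thesis .
  qed
  have conj: "(\<Sum>l<d. t i l * (z * (\<Sum>k<d. a l k * t k j) + of_bool (l = j))) =
      (\<Sum>l<d. (z * (\<Sum>k<d. t i k * a k l) + of_bool (i = l)) * t l j)"
    if ij: "i < d" "j < d" for t a :: "nat \<Rightarrow> nat \<Rightarrow> 'a poly" and z i j
  proof -
    have "(\<Sum>l<d. t i l * of_bool (l = j)) = t i j"
      using ij by (subst sum.remove[of _ j]) (auto intro!: sum.neutral)
    moreover have "(\<Sum>l<d. of_bool (i = l) * t l j) = t i j"
      using ij by (subst sum.remove[of _ i]) (auto intro!: sum.neutral)
    moreover have "(\<Sum>l<d. t i l * (z * (\<Sum>k<d. a l k * t k j))) =
        (\<Sum>l<d. z * (\<Sum>k<d. t i k * a k l) * t l j)"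
      by (simp add: sum_distrib_left sum_distrib_right mult_ac) (rule sum.swap)
    ultimately show ?thesis
      by (simp add: distrib_left distrib_right sum.distrib)
  qed
  have hom: "[:\<Sum>l<d. f l * g l:] = (\<Sum>l<d. [:f l:] * [:g l:])" for f g :: "nat \<Rightarrow> 'a"
    by (simp add: sum_const_poly mult.commute)
  have "[:minor {..<d} T:] * P ?AT = P ?TA * [:minor {..<d} T:]"
    unfolding P_def minor_const_poly[symmetric] minor_mult hom
    using conj[of _ _ "\<lambda>i j. [:T i j:]" ?z "\<lambda>i j. [:A i j:]"]
    by (intro minor_cong) simp
  then have "P ?AT = P ?TA" by (simp add: T flip: one_pCons)
  then show ?thesis using coeff[of ?AT] coeff[of ?TA] by simp
qed

section \<open>Laurent polynomials and the Cauchy kernel\<close>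

text \<open>The value at 0 is left open, since \<open>1 / u\<close> is 0 there by
  convention.\<close>

definition laurent :: "(complex \<Rightarrow> complex) \<Rightarrow> bool" where
  "laurent f \<longleftrightarrow> (\<exists>P m. \<forall>u. u \<noteq> 0 \<longrightarrow> f u = poly P u / u ^ m)"

lemma laurent_const [intro]: "laurent (\<lambda>_. c)"
  unfolding laurent_def by (rule exI[of _ "[:c:]"], rule exI[of _ 0]) simp

lemma laurent_ident [intro]: "laurent (\<lambda>u. u)"
  unfolding laurent_def by (rule exI[of _ "[:0, 1:]"], rule exI[of _ 0]) simp

lemma laurent_inverse [intro]: "laurent (\<lambda>u. 1 / u)"
  unfolding laurent_def by (rule exI[of _ "[:1:]"], rule exI[of _ 1]) simp

lemma laurent_mult [intro]:
  assumes "laurent f" "laurent g" shows "laurent (\<lambda>u. f u * g u)"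
proof -
  obtain P m Q n where "\<And>u. u \<noteq> 0 \<Longrightarrow> f u = poly P u / u ^ m" "\<And>u. u \<noteq> 0 \<Longrightarrow> g u = poly Q u / u ^ n"
    using assms unfolding laurent_def by blast
  then have "\<forall>u. u \<noteq> 0 \<longrightarrow> f u * g u = poly (P * Q) u / u ^ (m + n)"
    by (simp add: power_add)
  then show ?thesis unfolding laurent_def by blast
qed

lemma laurent_add [intro]:
  assumes "laurent f" "laurent g" shows "laurent (\<lambda>u. f u + g u)"
proof -
  obtain P m Q n where "\<And>u. u \<noteq> 0 \<Longrightarrow> f u = poly P u / u ^ m" "\<And>u. u \<noteq> 0 \<Longrightarrow> g u = poly Q u / u ^ n"
    using assms unfolding laurent_def by blast
  then have "\<forall>u. u \<noteq> 0 \<longrightarrow> f u + g u = poly (P * monom 1 n + Q * monom 1 m) u / u ^ (m + n)"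
    by (simp add: power_add poly_monom field_simps)
  then show ?thesis unfolding laurent_def by blast
qed

lemma laurent_diff [intro]: "laurent f \<Longrightarrow> laurent g \<Longrightarrow> laurent (\<lambda>u. f u - g u)"
  using laurent_add[of f "\<lambda>u. -1 * g u"] laurent_mult[of "\<lambda>_. -1" g] by auto

lemma laurent_divide_const [intro]: "laurent f \<Longrightarrow> laurent (\<lambda>u. f u / c)"
  using laurent_mult[of f "\<lambda>u. 1 / c"] by auto

lemma laurent_sum [intro]: "(\<And>x. x \<in> A \<Longrightarrow> laurent (f x)) \<Longrightarrow> laurent (\<lambda>u. \<Sum>x\<in>A. f x u)"
  by (induction A rule: infinite_finite_induct) auto

lemma laurent_prod [intro]: "(\<And>x. x \<in> A \<Longrightarrow> laurent (f x)) \<Longrightarrow> laurent (\<lambda>u. \<Prod>x\<in>A. f x u)"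
  by (induction A rule: infinite_finite_induct) auto

lemma laurent_power [intro]: "laurent f \<Longrightarrow> laurent (\<lambda>u. f u ^ n)"
  by (induction n) auto

lemma laurent_minor [intro]: "(\<And>i j. laurent (\<lambda>u. M u i j)) \<Longrightarrow> laurent (\<lambda>u. minor B (M u))"
  unfolding minor_def by (intro laurent_sum laurent_mult laurent_const laurent_prod)

text \<open>The numerator of the difference is a polynomial with infinitely many roots. This permits
  specialising \<open>u\<close> to powers of \<open>p\<close> and avoiding countably many bad
  values.\<close>

lemma laurent_eqI:
  assumes "laurent f" "laurent g" and inf: "infinite {u. u \<noteq> 0 \<and> f u = g u}" and "v \<noteq> 0"
  shows "f v = g v"
proof -
  obtain P m where P: "\<And>u. u \<noteq> 0 \<Longrightarrow> f u - g u = poly P u / u ^ m"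
    using laurent_diff[OF assms(1,2)] unfolding laurent_def by blast
  have "P = 0"
  proof (rule ccontr)
    assume "P \<noteq> 0"
    then have "finite {u. poly P u = 0}" by (rule poly_roots_finite)
    moreover have "{u. u \<noteq> 0 \<and> f u = g u} \<subseteq> {u. poly P u = 0}"
      using P by fastforce
    ultimately show False using inf finite_subset by blast
  qed
  then show ?thesis using P[OF \<open>v \<noteq> 0\<close>] by simp
qed

section \<open>The Toeplitz kernel and its Cauchy form\<close>

definition qpoch :: "complex \<Rightarrow> complex \<Rightarrow> nat \<Rightarrow> complex" where
  "qpoch p u k = (\<Prod>i<k. 1 - u * p ^ i)"

text \<open>With (u; p)_k for \<open>qpoch p u k\<close>, this is (u; p)_k / (p; p)_k, the
  coefficient of x^k in the q-binomial series.\<close>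

definition qh :: "complex \<Rightarrow> complex \<Rightarrow> nat \<Rightarrow> complex" where
  "qh p u k = qpoch p u k / qpoch p p k"

text \<open>Entry of a lower times an upper triangular Toeplitz matrix, with inner index
  \<open>m\<close>.\<close>

definition kernel1 :: "complex \<Rightarrow> complex \<Rightarrow> nat \<Rightarrow> nat \<Rightarrow> complex" where
  "kernel1 p u i j = (\<Sum>m\<le>min i j. qh p u (i - m) * (p ^ (j - m) * qh p (1 / u) (j - m)))"

text \<open>Interleaves \<open>r\<close> copies of \<open>kernel1\<close>, one per residue class: a
  hook length is divisible by \<open>r\<close> exactly if it is the difference of two numbers with
  equal residue.\<close>

definition fock_kernel :: "nat \<Rightarrow> complex \<Rightarrow> complex \<Rightarrow> nat \<Rightarrow> nat \<Rightarrow> complex" where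
  "fock_kernel r p u i j = (if i mod r = j mod r then kernel1 p u (i div r) (j div r) else 0)"

definition hook_weight :: "nat \<Rightarrow> complex \<Rightarrow> complex \<Rightarrow> nat \<Rightarrow> complex" where
  "hook_weight r p u h =
    (if r dvd h then (1 - u * p ^ (h div r)) * (1 - p ^ (h div r) / u) / (1 - p ^ (h div r))\<^sup>2 else 1)"

lemma qpoch_0 [simp]: "qpoch p u 0 = 1"
  by (simp add: qpoch_def)

lemma qpoch_Suc: "qpoch p u (Suc k) = qpoch p u k * (1 - u * p ^ k)"
  by (simp add: qpoch_def)

lemma qpoch_Suc_shift: "qpoch p u (Suc k) = (1 - u) * qpoch p (u * p) k"
  unfolding qpoch_def by (subst prod.lessThan_Suc_shift) (simp add: mult_ac)

lemma laurent_fock_kernel [intro]: "laurent (\<lambda>u. fock_kernel r p u i j)"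
proof -
  have "laurent (\<lambda>u. kernel1 p u i j)" for i j
    unfolding kernel1_def qh_def qpoch_def by (intro laurent_sum laurent_mult laurent_divide_const
      laurent_prod laurent_diff laurent_const laurent_ident laurent_inverse)
  then show ?thesis unfolding fock_kernel_def by (cases "i mod r = j mod r") auto
qed

lemma laurent_hook_weight [intro]: "laurent (\<lambda>u. hook_weight r p u h)"
proof -
  have *: "p ^ k / u = p ^ k * (1 / u)" for u :: complex and k by simp
  show ?thesis
  proof (cases "r dvd h")
    case True
    then show ?thesis
      unfolding hook_weight_def if_P[OF True] * by (intro laurent_mult laurent_divide_const
        laurent_diff laurent_const laurent_ident laurent_inverse)
  qed (auto simp: hook_weight_def)
qed

lemma kernel1_0_left: "kernel1 p u 0 j = p ^ j * qh p (1 / u) j"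
  by (simp add: kernel1_def qh_def)

lemma kernel1_0_right: "kernel1 p u i 0 = qh p u i"
  by (simp add: kernel1_def qh_def)

text \<open>Splitting off the inner index 0 leaves the previous entry on the diagonal, so the
  displacement has rank one; this is the source of the Cauchy form.\<close>

lemma kernel1_Suc_Suc:
  "kernel1 p u (Suc i) (Suc j) = kernel1 p u i j + qh p u (Suc i) * (p ^ Suc j * qh p (1 / u) (Suc j))"
  unfolding kernel1_def by (simp only: min_Suc_Suc sum.atMost_Suc_shift) simp

locale generic_base =
  fixes p :: complex
  assumes p0: "p \<noteq> 0" and p1: "\<And>k. k \<ge> 1 \<Longrightarrow> p ^ k \<noteq> 1"
begin

lemma p1': "p ^ Suc k \<noteq> 1" using p1[of "Suc k"] by simp

lemma qpoch_p_nz [simp]: "qpoch p p k \<noteq> 0"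
  using p1' by (auto simp: qpoch_def)

text \<open>Up to factors depending on \<open>i\<close> or \<open>j\<close> alone the entry is 1 /
  (p^j - u p^i). The denominator is multiplied out so that it may vanish. The induction descends
  along diagonals.\<close>

lemma kernel1_closed:
  assumes "u \<noteq> 0"
  shows "(p ^ j - u * p ^ i) * kernel1 p u i j =
    p ^ j * (qpoch p u (Suc i) / qpoch p p i) * (qpoch p (p / u) j / qpoch p p j)"
proof (induction i arbitrary: j)
  case 0
  have "qpoch p (1 / u) j * (1 - 1 / u * p ^ j) = (1 - 1 / u) * qpoch p (1 / u * p) j"
    using qpoch_Suc[of p "1 / u" j] qpoch_Suc_shift[of p "1 / u" j] by simp
  then have "qpoch p (1 / u) j * (p ^ j - u) = (1 - u) * qpoch p (p / u) j"
    using assms by (simp add: field_simps)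
  then show ?case
    by (simp add: kernel1_0_left qh_def qpoch_Suc mult_ac)
next
  case (Suc i)
  show ?case
  proof (cases j)
    case 0
    then show ?thesis by (simp add: kernel1_0_right qh_def qpoch_Suc)
  next
    case (Suc l)
    define A where "A = qpoch p u (Suc i)"
    define B where "B = qpoch p (p / u) l"
    define C where "C = qpoch p p i"
    define D where "D = qpoch p p l"
    have nz: "C \<noteq> 0" "D \<noteq> 0" "1 - p * p ^ i \<noteq> 0" "1 - p * p ^ l \<noteq> 0"
      using p1'[of i] p1'[of l] by (auto simp: C_def D_def)
    have e: "qpoch p (1 / u) (Suc l) = (1 - 1 / u) * B"
      by (simp add: B_def qpoch_Suc_shift)
    have IH: "(p ^ l - u * p ^ i) * kernel1 p u i l = p ^ l * (A / C) * (B / D)"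
      unfolding A_def B_def C_def D_def by (rule Suc.IH)
    have "(p ^ j - u * p ^ Suc i) * kernel1 p u (Suc i) j =
      p * ((p ^ l - u * p ^ i) * kernel1 p u i l) + p * (p ^ l - u * p ^ i) *
        (A / (C * (1 - p * p ^ i)) * (p ^ Suc l * ((1 - 1 / u) * B / (D * (1 - p * p ^ l)))))"
      unfolding Suc kernel1_Suc_Suc qh_def e unfolding A_def C_def D_def
      by (simp add: qpoch_Suc algebra_simps)
    also have "\<dots> = p ^ Suc l * (A * (1 - u * p ^ Suc i) / (C * (1 - p * p ^ i))) *
        (B * (1 - p / u * p ^ l) / (D * (1 - p * p ^ l)))"
      unfolding IH using nz assms by (simp add: divide_simps) (simp add: algebra_simps)
    finally show ?thesis
      unfolding Suc by (simp add: A_def B_def C_def D_def qpoch_Suc[of _ _ i] qpoch_Suc[of _ _ l]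
        qpoch_Suc[of _ _ "Suc i"])
  qed
qed

text \<open>Remove the largest element \<open>s\<close>. The Schur complement of a Cauchy matrix is
  the same matrix with rows and columns rescaled, by \<open>\<phi>\<close> and
  \<open>\<psi>\<close>. The pivot is the product of the weights over all \<open>b < s\<close>, and
  the rescaling cancels those with \<open>b\<close> in \<open>B\<close>. The condition
  \<open>gen\<close> keeps Cauchy denominators and pivots nonzero.\<close>

lemma fock_kernel_minor_generic:
  assumes r: "r \<ge> 1" and gen: "\<And>i j. p ^ j \<noteq> u * p ^ i" and "u \<noteq> 0" and "finite B"
  shows "minor B (fock_kernel r p u) = (\<Prod>a\<in>B. \<Prod>b\<in>{..<a} - B. hook_weight r p u (a - b))"
  using \<open>finite B\<close>
proof (induction rule: finite_linorder_max_induct)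
  case empty
  show ?case by (simp add: minor_def)
next
  case (insert s B)
  \<comment> \<open>\<open>x\<close> gives the nodes of the Cauchy matrix, \<open>a\<close> and
    \<open>b\<close> below its row and column factors.\<close>
  define x where "x = (\<lambda>i. p ^ (i div r))"
  define \<phi> where "\<phi> = (\<lambda>i. if i mod r = s mod r then (x s - x i) / (x s - u * x i) else 1)"
  define \<psi> where "\<psi> = (\<lambda>j. if j mod r = s mod r then u * (x j - x s) / (x j - u * x s) else 1)"
  define a where "a = (\<lambda>i. qpoch p u (Suc (i div r)) / qpoch p p (i div r))"
  define b where "b = (\<lambda>j. qpoch p (p / u) (j div r) / qpoch p p (j div r))"
  have gx: "x i - u * x j \<noteq> 0" for i j using gen by (simp add: x_def)
  have x0: "x i \<noteq> 0" for i using p0 by (simp add: x_def)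
  have K: "fock_kernel r p u i j = x j * a i * b j / (x j - u * x i)" if "i mod r = j mod r" for i j
    using kernel1_closed[OF \<open>u \<noteq> 0\<close>, of "j div r" "i div r"] gx[of j i] that
    by (simp add: fock_kernel_def x_def a_def b_def field_simps)
  have K0: "fock_kernel r p u i j = 0" if "i mod r \<noteq> j mod r" for i j
    using that by (simp add: fock_kernel_def)
  have a0: "a i \<noteq> 0" for i
  proof -
    have "u * p ^ l \<noteq> 1" for l using gen[of 0 l] by auto
    then have "qpoch p u (Suc (i div r)) \<noteq> 0" by (auto simp: qpoch_def)
    then show ?thesis by (simp add: a_def)
  qed
  have b0: "b i \<noteq> 0" for i
  proof -
    have "p / u * p ^ l \<noteq> 1" for l using gen[of "Suc l" 0] \<open>u \<noteq> 0\<close> by (auto simp: field_simps)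
    then have "qpoch p (p / u) (i div r) \<noteq> 0" by (auto simp: qpoch_def)
    then show ?thesis by (simp add: b_def)
  qed
  have u1: "1 - u \<noteq> 0" using gen[of 0 0] by simp
  have ss: "fock_kernel r p u s s = a s * b s / (1 - u)"
  proof -
    have "x s - u * x s = x s * (1 - u)" by (simp add: algebra_simps)
    then show ?thesis using K[of s s] x0[of s] by (simp only:) simp
  qed
  then have Kss: "fock_kernel r p u s s \<noteq> 0"
    using a0 b0 u1 by simp
  have compl: "fock_kernel r p u i j - fock_kernel r p u s j / fock_kernel r p u s s * fock_kernel r p u i s =
      \<phi> i * fock_kernel r p u i j * \<psi> j" for i j
  proof (cases "i mod r = s mod r \<and> j mod r = s mod r")
    case True
    \<comment> \<open>The scalar identity behind Cauchy's determinant: the entry minus its rank one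
      correction factors.\<close>
    have id: "x j / (x j - u * x i) - x j * x s * (1 - u) / ((x j - u * x s) * (x s - u * x i)) =
        (x s - x i) / (x s - u * x i) * (x j / (x j - u * x i)) * (u * (x j - x s) / (x j - u * x s))"
      using gx[of j i] gx[of j s] gx[of s i]
      by (simp add: divide_simps) (simp add: algebra_simps)
    have "fock_kernel r p u i j - fock_kernel r p u s j / fock_kernel r p u s s * fock_kernel r p u i s =
      a i * b j * (x j / (x j - u * x i) - x j * x s * (1 - u) / ((x j - u * x s) * (x s - u * x i)))"
    proof -
      have alg: "xj * as * bj / D1 / (as * bs / U) * (xs * ai * bs / D2) = ai * bj * (xj * xs * U / (D1 * D2))"
        if "as \<noteq> 0" "bs \<noteq> 0" for xj as bj D1 bs U xs ai D2 :: complex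
        using that by (simp add: divide_simps)
      have "fock_kernel r p u s j / fock_kernel r p u s s * fock_kernel r p u i s =
          a i * b j * (x j * x s * (1 - u) / ((x j - u * x s) * (x s - u * x i)))"
        unfolding ss using True alg[OF a0 b0] by (simp only: K)
      then show ?thesis
        using True K[of i j] by (simp add: right_diff_distrib mult_ac)
    qed
    also have "\<dots> = \<phi> i * fock_kernel r p u i j * \<psi> j"
      unfolding id using True by (simp add: K \<phi>_def \<psi>_def)
    finally show ?thesis .
  next
    case False
    then show ?thesis
      using K0[of i s] K0[of s j] K0[of i j] by (auto simp: \<phi>_def \<psi>_def)
  qed
  have cancel: "\<phi> j * \<psi> j * hook_weight r p u (s - j) = 1" if "j \<in> B" for j
  proof -
    have "j < s" using insert that by auto
    show ?thesis
    proof (cases "j mod r = s mod r")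
      case True
      then have dvd: "r dvd s - j" using \<open>j < s\<close> mod_eq_dvd_iff_nat[of j s r] by simp
      then obtain h where h: "s = j + r * h" using \<open>j < s\<close>
        by (metis dvd_def le_add_diff_inverse less_imp_le)
      have "h \<noteq> 0" using h \<open>j < s\<close> by auto
      define P where "P = p ^ h"
      have P1: "1 - P \<noteq> 0" using p1[of h] \<open>h \<noteq> 0\<close> by (simp add: P_def)
      have Pu: "1 - u * P \<noteq> 0" "P - u \<noteq> 0" using gen[of 0 h] gen[of h 0] by (auto simp: P_def)
      have xs: "x s = x j * P" using r by (simp add: x_def P_def h power_add)
      have e1: "x s - x j = - x j * (1 - P)" "x s - u * x j = x j * (P - u)"
        "x j - x s = x j * (1 - P)" "x j - u * x s = x j * (1 - u * P)"
        unfolding xs by (simp_all add: algebra_simps)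
      have "\<phi> j * \<psi> j = - u * (1 - P)\<^sup>2 / ((P - u) * (1 - u * P))"
        unfolding \<phi>_def \<psi>_def using True x0[of j]
        by (simp add: e1 power2_eq_square)
      moreover have "hook_weight r p u (s - j) = (1 - u * P) * (1 - P / u) / (1 - P)\<^sup>2"
        using r by (simp add: hook_weight_def h P_def)
      moreover have "- u * (1 - P)\<^sup>2 / ((P - u) * (1 - u * P)) *
          ((1 - u * P) * (1 - P / u) / (1 - P)\<^sup>2) = 1"
        using P1 Pu \<open>u \<noteq> 0\<close> by (simp add: divide_simps)
      ultimately show ?thesis by (simp only:)
    next
      case False
      then have "\<not> r dvd s - j" using \<open>j < s\<close> by (metis less_imp_le mod_eq_dvd_iff_nat)
      then show ?thesis using False by (simp add: \<phi>_def \<psi>_def hook_weight_def)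
    qed
  qed
  \<comment> \<open>Only multiples of \<open>r\<close> have nontrivial weight, and the product over
    them is a ratio of Pochhammer symbols.\<close>
  have diag: "fock_kernel r p u s s = (\<Prod>b<s. hook_weight r p u (s - b))"
  proof -
    have "(\<Prod>b<s. hook_weight r p u (s - b)) = (\<Prod>h\<in>{1..s}. hook_weight r p u h)"
      by (rule prod.reindex_bij_witness[of _ "\<lambda>h. s - h" "\<lambda>b. s - b"]) auto
    also have "\<dots> = (\<Prod>h\<in>(\<lambda>k. r * k) ` {1..s div r}. hook_weight r p u h)"
    proof (rule prod.mono_neutral_right)
      show "(*) r ` {1..s div r} \<subseteq> {1..s}"
        using r by (auto simp: less_eq_div_iff_mult_less_eq mult.commute Suc_le_eq)
      show "\<forall>i\<in>{1..s} - (*) r ` {1..s div r}. hook_weight r p u i = 1"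
      proof
        fix i assume i: "i \<in> {1..s} - (*) r ` {1..s div r}"
        have "\<not> r dvd i"
        proof
          assume "r dvd i"
          then obtain k where k: "i = r * k" by auto
          then have "k \<in> {1..s div r}"
            using i r by (auto simp: less_eq_div_iff_mult_less_eq mult.commute Suc_le_eq)
          with i k show False by blast
        qed
        then show "hook_weight r p u i = 1" by (simp add: hook_weight_def)
      qed
    qed auto
    also have "\<dots> = (\<Prod>k\<in>{1..s div r}. (1 - u * p ^ k) * (1 - p ^ k / u) / (1 - p ^ k)\<^sup>2)"
      using r by (subst prod.reindex) (auto simp: inj_on_def hook_weight_def)
    also have "\<dots> = (\<Prod>k<s div r. (1 - u * p ^ Suc k) * (1 - p ^ Suc k / u) / (1 - p ^ Suc k)\<^sup>2)"
      by (rule prod.reindex_bij_witness[of _ Suc "\<lambda>k. k - 1"]) auto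
    also have "\<dots> = a s * b s / (1 - u)"
      unfolding a_def b_def qpoch_Suc_shift using u1
      by (simp add: qpoch_def prod_dividef prod.distrib power2_eq_square mult_ac)
    also have "\<dots> = fock_kernel r p u s s" by (rule ss[symmetric])
    finally show ?thesis by simp
  qed
  have "s \<notin> B" using insert by auto
  have "minor (insert s B) (fock_kernel r p u) = fock_kernel r p u s s *
      minor B (\<lambda>i j. fock_kernel r p u i j - fock_kernel r p u s j / fock_kernel r p u s s * fock_kernel r p u i s)"
    using insert \<open>s \<notin> B\<close> Kss by (intro minor_insert) auto
  also have "\<dots> = fock_kernel r p u s s * (prod \<phi> B * prod \<psi> B * minor B (fock_kernel r p u))"
    unfolding compl minor_scale ..
  also have "fock_kernel r p u s s = (\<Prod>b\<in>{..<s} - B. hook_weight r p u (s - b)) * (\<Prod>b\<in>B. hook_weight r p u (s - b))"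
    unfolding diag using insert by (subst prod.subset_diff[of B "{..<s}"]) auto
  also have "\<dots> * (prod \<phi> B * prod \<psi> B * minor B (fock_kernel r p u)) =
      (\<Prod>b\<in>{..<s} - B. hook_weight r p u (s - b)) * minor B (fock_kernel r p u) *
      (\<Prod>j\<in>B. \<phi> j * \<psi> j * hook_weight r p u (s - j))"
    by (simp add: prod.distrib mult_ac)
  also have "(\<Prod>j\<in>B. \<phi> j * \<psi> j * hook_weight r p u (s - j)) = 1"
    using cancel by (intro prod.neutral) auto
  also have "(\<Prod>b\<in>{..<s} - B. hook_weight r p u (s - b)) =
      (\<Prod>b\<in>{..<s} - insert s B. hook_weight r p u (s - b))"
    by (intro prod.cong) auto
  also have "minor B (fock_kernel r p u) = (\<Prod>a\<in>B. \<Prod>b\<in>{..<a} - insert s B. hook_weight r p u (a - b))"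
    unfolding insert.IH using insert by (intro prod.cong) auto
  finally show ?case using insert \<open>s \<notin> B\<close> by simp
qed

text \<open>Both sides are Laurent polynomials in \<open>u\<close>, and genericity excludes only
  countably many values.\<close>

lemma fock_kernel_minor:
  assumes r: "r \<ge> 1" and "u \<noteq> 0" and "finite B"
  shows "minor B (fock_kernel r p u) = (\<Prod>a\<in>B. \<Prod>b\<in>{..<a} - B. hook_weight r p u (a - b))"
proof (rule laurent_eqI[where v = u])
  define E where "E = insert 0 (range (\<lambda>(i, j). p ^ j / p ^ i))"
  have "countable E" unfolding E_def by auto
  then have "uncountable (UNIV - E)"
    using uncountable_UNIV_complex uncountable_minus_countable by blast
  then have "infinite (UNIV - E)" by (rule uncountable_infinite)
  moreover have "UNIV - E \<subseteq> {u. u \<noteq> 0 \<and> minor B (fock_kernel r p u) =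
      (\<Prod>a\<in>B. \<Prod>b\<in>{..<a} - B. hook_weight r p u (a - b))}"
  proof
    fix u assume u: "u \<in> UNIV - E"
    have "p ^ j \<noteq> u * p ^ i" for i j
    proof
      assume "p ^ j = u * p ^ i"
      then have "u = p ^ j / p ^ i" using p0 by simp
      then show False using u by (auto simp: E_def)
    qed
    then show "u \<in> {u. u \<noteq> 0 \<and> minor B (fock_kernel r p u) =
      (\<Prod>a\<in>B. \<Prod>b\<in>{..<a} - B. hook_weight r p u (a - b))}"
      using u fock_kernel_minor_generic[OF r _ _ \<open>finite B\<close>] by (auto simp: E_def)
  qed
  ultimately show "infinite {u. u \<noteq> 0 \<and> minor B (fock_kernel r p u) =
      (\<Prod>a\<in>B. \<Prod>b\<in>{..<a} - B. hook_weight r p u (a - b))}"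
    using finite_subset by blast
  show "laurent (\<lambda>u. minor B (fock_kernel r p u))" by auto
  show "laurent (\<lambda>u. \<Prod>a\<in>B. \<Prod>b\<in>{..<a} - B. hook_weight r p u (a - b))"
    by (intro laurent_prod laurent_hook_weight)
qed (fact \<open>u \<noteq> 0\<close>)

end

section \<open>Traces over low energy states\<close>

text \<open>Congruence modulo \<open>q^(n+1)\<close>.\<close>

definition agree :: "nat \<Rightarrow> complex fps \<Rightarrow> complex fps \<Rightarrow> bool" where
  "agree n f g \<longleftrightarrow> (\<forall>k\<le>n. fps_nth f k = fps_nth g k)"

lemma agree_refl [simp, intro]: "agree n f f"
  by (simp add: agree_def)

lemma agreeD: "agree n f g \<Longrightarrow> k \<le> n \<Longrightarrow> fps_nth f k = fps_nth g k"
  by (simp add: agree_def)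

lemma agree_sym: "agree n f g \<Longrightarrow> agree n g f"
  by (simp add: agree_def)

lemma agree_trans [trans]: "agree n f g \<Longrightarrow> agree n g h \<Longrightarrow> agree n f h"
  by (simp add: agree_def)

text \<open>Without these rules, calculations fall back on higher-order substitution, which diverges here.\<close>

lemma agree_eq_trans [trans]:
  "agree n f g \<Longrightarrow> g = h \<Longrightarrow> agree n f h"
  "f = g \<Longrightarrow> agree n g h \<Longrightarrow> agree n f h"
  by simp_all

lemma agree_add [intro]: "agree n f g \<Longrightarrow> agree n f' g' \<Longrightarrow> agree n (f + f') (g + g')"
  by (simp add: agree_def)

lemma agree_mult [intro]: "agree n f g \<Longrightarrow> agree n f' g' \<Longrightarrow> agree n (f * f') (g * g')"
  unfolding agree_def fps_mult_nth by (intro allI impI sum.cong) auto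

lemma agree_sum [intro]: "(\<And>x. x \<in> A \<Longrightarrow> agree n (f x) (g x)) \<Longrightarrow> agree n (sum f A) (sum g A)"
  by (induction A rule: infinite_finite_induct) auto

lemma agree_prod [intro]: "(\<And>x. x \<in> A \<Longrightarrow> agree n (f x) (g x)) \<Longrightarrow> agree n (prod f A) (prod g A)"
  by (induction A rule: infinite_finite_induct) auto

lemma agree_X_power_0: "n < e \<Longrightarrow> agree n (fps_X ^ e * f) 0"
  by (simp add: agree_def fps_X_power_mult_nth)

lemma agree_minor:
  assumes "\<And>i j. agree n (M i j) (M' i j)"
  shows "agree n (minor B M) (minor B M')"
  unfolding minor_def by (intro agree_sum agree_mult agree_prod assms agree_refl)

lemma sum_lessThan_card_le: "finite B \<Longrightarrow> \<Sum>{..<card B} \<le> \<Sum>(B :: nat set)"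
proof (induction B rule: finite_linorder_max_induct)
  case (insert b A)
  then have "A \<subseteq> {..<b}" "b \<notin> A" by auto
  then have "card A \<le> b" using card_mono[of "{..<b}" A] by simp
  then show ?case using insert \<open>b \<notin> A\<close> by simp
qed simp

text \<open>Up to the shift \<open>0 + \<dots> + (N - 1)\<close>, the sum of a set of beta numbers is the size of the partition.
  Low sets lie in an initial segment and contain an initial segment, so only a finite part of an
  infinite matrix matters, and its low columns are always available for column operations.\<close>

definition low_sets :: "nat \<Rightarrow> nat \<Rightarrow> nat set set" where
  "low_sets N m = {B. finite B \<and> card B = N \<and> \<Sum>B \<le> \<Sum>{..<N} + m}"

text \<open>The other \<open>N - 1\<close> elements sum to at least
  \<open>0 + ... + (N - 2)\<close>, which leaves at most \<open>N - 1 + m\<close> for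
  \<open>b\<close>.\<close>

lemma low_sets_upper:
  assumes "B \<in> low_sets N m" shows "B \<subseteq> {..<N + m}"
proof
  fix b assume b: "b \<in> B"
  have B: "finite B" "card B = N" "\<Sum>B \<le> \<Sum>{..<N} + m" using assms by (auto simp: low_sets_def)
  obtain M where N: "N = Suc M" using b B by (cases N) auto
  have "\<Sum>{..<M} + b \<le> \<Sum>(B - {b}) + b"
    using N sum_lessThan_card_le[of "B - {b}"] b B by simp
  also have "\<dots> = \<Sum>B" using b B by (simp add: sum.remove)
  also have "\<dots> \<le> \<Sum>{..<Suc M} + m" using B N by simp
  finally show "b \<in> {..<N + m}" using N by auto
qed

text \<open>Were \<open>i\<close> missing, adding it would give \<open>N + 1\<close> elements of sum
  at least \<open>0 + ... + N\<close>, forcing \<open>i + m\<close> up to \<open>N\<close>.\<close>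

lemma low_sets_lower:
  assumes "B \<in> low_sets N m" "i + m < N" shows "i \<in> B"
proof (rule ccontr)
  assume i: "i \<notin> B"
  have B: "finite B" "card B = N" "\<Sum>B \<le> \<Sum>{..<N} + m" using assms by (auto simp: low_sets_def)
  have "\<Sum>{..<Suc N} \<le> i + \<Sum>B"
    using sum_lessThan_card_le[of "insert i B"] i B by simp
  then show False using B assms by simp
qed

lemma finite_low_sets [simp]: "finite (low_sets N m)"
  by (rule finite_subset[of _ "Pow {..<N + m}"]) (auto dest!: low_sets_upper)

text \<open>The trace of \<open>q^L M\<close> on the \<open>N\<close>-th exterior power, restricted
  to low energy states.\<close>

definition fock_trace :: "nat \<Rightarrow> nat \<Rightarrow> (nat \<Rightarrow> nat \<Rightarrow> complex fps) \<Rightarrow> complex fps" where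
  "fock_trace N m M = (\<Sum>B\<in>low_sets N m. fps_X ^ \<Sum>B * minor B M)"

lemma fock_trace_full:
  assumes "d \<ge> N + m"
  shows "agree (\<Sum>{..<N} + m)
    (\<Sum>B | B \<subseteq> {..<d} \<and> card B = N. fps_X ^ \<Sum>B * minor B M) (fock_trace N m M)"
proof -
  let ?S = "{B. B \<subseteq> {..<d} \<and> card B = N}"
  have fin: "finite ?S" by simp
  have sub: "low_sets N m \<subseteq> ?S"
  proof
    fix B assume "B \<in> low_sets N m"
    then show "B \<in> ?S"
      using low_sets_upper[of B N m] assms by (auto simp: low_sets_def)
  qed
  have "agree (\<Sum>{..<N} + m) (\<Sum>B\<in>?S - low_sets N m. fps_X ^ \<Sum>B * minor B M)
      (\<Sum>B\<in>?S - low_sets N m. 0)"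
    by (intro agree_sum agree_X_power_0) (auto simp: low_sets_def finite_subset[of _ "{..<d}"])
  then have "agree (\<Sum>{..<N} + m) ((\<Sum>B\<in>?S - low_sets N m. fps_X ^ \<Sum>B * minor B M) +
      fock_trace N m M) (0 + fock_trace N m M)"
    by (intro agree_add) auto
  then show ?thesis
    unfolding fock_trace_def using sum.subset_diff[OF sub fin, of "\<lambda>B. fps_X ^ \<Sum>B * minor B M"]
    by simp
qed

text \<open>Multiplication by \<open>1 + y w^-r\<close> from the left (rows) and from the right (columns), where \<open>w\<close> is
  the shift \<open>e_j \<mapsto> e_(j+1)\<close>.\<close>

definition shift_row :: "nat \<Rightarrow> complex fps \<Rightarrow> (nat \<Rightarrow> nat \<Rightarrow> complex fps) \<Rightarrow> nat \<Rightarrow> nat \<Rightarrow> complex fps" where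
  "shift_row r y M = (\<lambda>i j. M i j + y * M (i + r) j)"

definition shift_col :: "nat \<Rightarrow> complex fps \<Rightarrow> (nat \<Rightarrow> nat \<Rightarrow> complex fps) \<Rightarrow> nat \<Rightarrow> nat \<Rightarrow> complex fps" where
  "shift_col r y M = (\<lambda>i j. M i j + (if r \<le> j then y * M i (j - r) else 0))"

lemma shift_row_col_commute:
  "shift_row r y (shift_col r y' M) = shift_col r y' (shift_row r y M)"
  by (auto simp: shift_row_def shift_col_def fun_eq_iff algebra_simps)

lemma foldr_shift_commute:
  "foldr (shift_row r) ys (shift_col r y M) = shift_col r y (foldr (shift_row r) ys M)"
  "shift_row r y (foldr (shift_col r) ys M) = foldr (shift_col r) ys (shift_row r y M)"
  by (induction ys) (auto simp: shift_row_col_commute)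

text \<open>Cut the matrices to size \<open>d\<close> and apply \<open>sum_minors_cyclic\<close> to
  \<open>A = q^L M\<close> and \<open>T = 1 + y w^-r\<close>. In \<open>T A\<close> the row coming
  from \<open>i + r\<close> carries \<open>q^(i + r)\<close>, so \<open>y\<close> turns into
  \<open>y q^r\<close>.\<close>

lemma fock_trace_cyclic:
  assumes r: "r \<ge> 1"
  shows "agree (\<Sum>{..<N} + m) (fock_trace N m (shift_col r y M))
    (fock_trace N m (shift_row r (y * fps_X ^ r) M))"
proof -
  \<comment> \<open>Low sets lie below \<open>N + m\<close>; the \<open>r\<close> further rows keep
    row \<open>i + r\<close> inside the cut-off.\<close>
  define d where "d = N + m + r"
  define T where "T = (\<lambda>i j. of_bool (i = j) + (if j = i + r then y else 0))"
  define A where "A = (\<lambda>i j. fps_X ^ i * M i j)"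
  define M' where "M' = (\<lambda>i j. M i j + (if i + r < d then y * fps_X ^ r * M (i + r) j else 0))"
  let ?S = "{B. B \<subseteq> {..<d} \<and> card B = N}"
  have T1: "minor {..<d} T = 1"
    using r by (intro minor_upper_unitriangular) (auto simp: T_def)
  have scale: "fps_X ^ \<Sum>B * minor B C = minor B (\<lambda>i j. fps_X ^ i * C i j)" for B and C :: "nat \<Rightarrow> nat \<Rightarrow> complex fps"
    using minor_scale[of B "\<lambda>i. fps_X ^ i" C "\<lambda>_. 1"] by (simp add: power_sum)
  have "agree (\<Sum>{..<N} + m) (fock_trace N m (shift_col r y M))
      (\<Sum>B\<in>?S. fps_X ^ \<Sum>B * minor B (shift_col r y M))"
    by (rule agree_sym, rule fock_trace_full) (simp add: d_def)
  also have "(\<Sum>B\<in>?S. fps_X ^ \<Sum>B * minor B (shift_col r y M)) =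
      (\<Sum>B\<in>?S. minor B (\<lambda>i j. \<Sum>l<d. A i l * T l j))"
    unfolding scale
  proof (intro sum.cong refl minor_cong)
    fix B i j assume "B \<in> ?S" "i \<in> B" "j \<in> B"
    then have ij: "i < d" "j < d" by auto
    have "(\<Sum>l<d. A i l * of_bool (l = j)) = A i j"
      using ij by (subst sum.remove[of _ j]) (auto intro!: sum.neutral)
    moreover have "(\<Sum>l<d. A i l * (if j = l + r then y else 0)) = (if r \<le> j then A i (j - r) * y else 0)"
    proof (cases "r \<le> j")
      case True
      then show ?thesis using ij by (subst sum.remove[of _ "j - r"]) (auto intro!: sum.neutral split: if_splits)
    qed (auto intro!: sum.neutral)
    ultimately show "fps_X ^ i * shift_col r y M i j = (\<Sum>l<d. A i l * T l j)"
      by (simp add: T_def distrib_left sum.distrib A_def shift_col_def mult_ac)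
  qed
  also have "\<dots> = (\<Sum>B\<in>?S. minor B (\<lambda>i j. \<Sum>l<d. T i l * A l j))"
    by (rule sum_minors_cyclic[OF T1])
  also have "\<dots> = (\<Sum>B\<in>?S. fps_X ^ \<Sum>B * minor B M')"
    unfolding scale
  proof (intro sum.cong refl minor_cong)
    fix B i j assume "B \<in> ?S" "i \<in> B" "j \<in> B"
    then have ij: "i < d" "j < d" by auto
    have "(\<Sum>l<d. of_bool (i = l) * A l j) = A i j"
      using ij by (subst sum.remove[of _ i]) (auto intro!: sum.neutral)
    moreover have "(\<Sum>l<d. (if l = i + r then y else 0) * A l j) = (if i + r < d then y * A (i + r) j else 0)"
    proof (cases "i + r < d")
      case True
      then show ?thesis using ij by (subst sum.remove[of _ "i + r"]) (auto intro!: sum.neutral)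
    qed (auto intro!: sum.neutral)
    ultimately show "(\<Sum>l<d. T i l * A l j) = fps_X ^ i * M' i j"
      by (simp add: T_def distrib_left distrib_right sum.distrib A_def M'_def power_add mult_ac)
  qed
  also have "agree (\<Sum>{..<N} + m) \<dots> (fock_trace N m M')"
    by (rule fock_trace_full) (simp add: d_def)
  also have "fock_trace N m M' = fock_trace N m (shift_row r (y * fps_X ^ r) M)"
    unfolding fock_trace_def
    by (intro sum.cong refl arg_cong2[where f = "(*)"] minor_cong)
      (auto simp: M'_def shift_row_def d_def dest!: low_sets_upper)
  finally show ?thesis .
qed

section \<open>Toeplitz matrices whose inverse symbol is a polynomial\<close>

definition toeplitz :: "nat \<Rightarrow> (nat \<Rightarrow> complex fps) \<Rightarrow> nat \<Rightarrow> nat \<Rightarrow> complex fps" where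
  "toeplitz r h i j = (if j \<le> i \<and> i mod r = j mod r then h ((i - j) div r) else 0)"

text \<open>A permutation other than the identity has some \<open>\<pi> j < j\<close>, which selects
  a zero above the diagonal.\<close>

lemma minor_toeplitz:
  assumes "finite B" "h 0 = 1"
  shows "minor B (toeplitz r h) = 1"
proof -
  have "minor B (toeplitz r h) = (\<Sum>\<pi>\<in>{id}. of_int (sign \<pi>) * (\<Prod>j\<in>B. toeplitz r h (\<pi> j) j))"
    unfolding minor_def
  proof (rule sum.mono_neutral_right)
    show "finite {\<pi>. \<pi> permutes B}" using assms by (simp add: finite_permutations)
    show "{id} \<subseteq> {\<pi>. \<pi> permutes B}" by (simp add: permutes_id)
    show "\<forall>\<pi>\<in>{\<pi>. \<pi> permutes B} - {id}. of_int (sign \<pi>) * (\<Prod>j\<in>B. toeplitz r h (\<pi> j) j) = 0"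
    proof
      fix \<pi> assume "\<pi> \<in> {\<pi>. \<pi> permutes B} - {id}"
      then obtain j where "j \<in> B" "\<not> \<pi> j \<ge> j"
        using permutes_natset_ge[of \<pi> B] by auto
      then have "(\<Prod>j\<in>B. toeplitz r h (\<pi> j) j) = 0"
        using assms by (intro prod_zero) (auto simp: toeplitz_def intro!: bexI[of _ j])
      then show "of_int (sign \<pi>) * (\<Prod>j\<in>B. toeplitz r h (\<pi> j) j) = 0" by simp
    qed
  qed
  also have "\<dots> = 1" using assms by (simp add: toeplitz_def)
  finally show ?thesis .
qed

text \<open>Row operations act alike on all columns, so linear relations among columns survive
  them.\<close>

lemma shift_row_linear:
  assumes "\<And>i. A i j = (\<Sum>l\<in>I. c l * M i (f l))"
  shows "foldr (shift_row r) ys A i j = (\<Sum>l\<in>I. c l * foldr (shift_row r) ys M i (f l))"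
proof (induction ys arbitrary: i)
  case (Cons y ys)
  have "shift_row r y A i j = A i j + y * A (i + r) j" for A i j
    by (simp add: shift_row_def)
  then show ?case
    by (simp add: Cons sum_distrib_left sum.distrib distrib_left mult_ac)
qed (use assms in simp)

text \<open>\<open>\<epsilon>\<close> and \<open>h\<close> are coefficients of mutually inverse
  series, the first a polynomial of degree at most \<open>n\<close>.\<close>

locale toeplitz_pair =
  fixes r n :: nat and h \<epsilon> :: "nat \<Rightarrow> complex fps"
  assumes r: "r \<ge> 1" and h0: "h 0 = 1" and e0: "\<epsilon> 0 = 1" and en: "\<And>k. k > n \<Longrightarrow> \<epsilon> k = 0"
    and he: "\<And>k. k \<ge> 1 \<Longrightarrow> (\<Sum>l\<le>k. \<epsilon> l * h (k - l)) = 0"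
begin

definition E :: "complex fps \<Rightarrow> complex fps" where
  "E y = (\<Sum>i\<le>n. (- y) ^ i * \<epsilon> i)"

text \<open>The coefficients of the column relation below: the solution of the recursion
  \<open>G_rec\<close> that vanishes at \<open>n + 1\<close>.\<close>

definition G :: "complex fps \<Rightarrow> nat \<Rightarrow> complex fps" where
  "G y l = of_bool (l = 0) + (\<Sum>i<n. (- y) ^ Suc i * \<epsilon> (Suc i + l))"

lemma G_0: "G y 0 = E y"
proof -
  have "E y = (\<Sum>i\<in>{..<Suc n}. (- y) ^ i * \<epsilon> i)" by (simp add: E_def lessThan_Suc_atMost)
  also have "\<dots> = 1 + (\<Sum>i<n. (- y) ^ Suc i * \<epsilon> (Suc i))"
    by (subst sum.lessThan_Suc_shift) (simp add: e0)
  finally show ?thesis by (simp add: G_def)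
qed

text \<open>The sums telescope, and the upper boundary term lies beyond the degree of
  \<open>\<epsilon>\<close>.\<close>

lemma G_rec: "G y l + y * G y (Suc l) = of_bool (l = 0) - y * \<epsilon> (Suc l)"
proof -
  have "(\<Sum>i<n. (- y) ^ Suc i * \<epsilon> (Suc i + l)) + y * (\<Sum>i<n. (- y) ^ Suc i * \<epsilon> (Suc i + Suc l)) =
    - (\<Sum>i<n. (- y) ^ Suc (Suc i) * \<epsilon> (Suc (Suc i) + l) - (- y) ^ Suc i * \<epsilon> (Suc i + l))"
    by (simp add: sum_subtractf sum_distrib_left sum_negf sum.distrib mult_ac)
  also have "\<dots> = - ((- y) ^ Suc n * \<epsilon> (Suc n + l) - (- y) ^ Suc 0 * \<epsilon> (Suc 0 + l))"
    by (subst sum_lessThan_telescope[of "\<lambda>i. (- y) ^ Suc i * \<epsilon> (Suc i + l)"]) simp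
  also have "\<dots> = - y * \<epsilon> (Suc l)" by (simp add: en)
  finally show ?thesis unfolding G_def by (simp add: algebra_simps)
qed

text \<open>Commuting \<open>1 + y w^-r\<close> past a lower triangular Toeplitz matrix changes only its first \<open>r\<close>
  columns, by adding multiples of later columns and scaling by \<open>E y\<close>; here it matters that the inverse
  symbol is a polynomial.\<close>

lemma toeplitz_column_relation:
  assumes "j < r"
  shows "shift_row r y (toeplitz r h) i j = (\<Sum>l\<le>n. G y l * shift_col r y (toeplitz r h) i (j + r * l))"
proof (cases "i mod r = j")
  case False
  have T: "toeplitz r h i j' = 0" if "j' mod r = j" for j'
    using False that assms by (auto simp: toeplitz_def)
  have "toeplitz r h (i + r) j = 0" using False assms by (auto simp: toeplitz_def)
  moreover have "toeplitz r h i j = 0" using assms by (intro T) simp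
  moreover have "shift_col r y (toeplitz r h) i (j + r * l) = 0" for l
  proof (cases l)
    case 0
    then show ?thesis using assms by (simp add: shift_col_def T)
  next
    case (Suc k)
    then have "j + r * l - r = j + r * k" by simp
    then show ?thesis using assms by (simp add: shift_col_def T)
  qed
  ultimately show ?thesis by (simp add: shift_row_def)
next
  case True
  define k where "k = i div r"
  have i: "i = j + r * k" using True by (auto simp: k_def)
  \<comment> \<open>Without the case distinction, truncated subtraction would put \<open>h 0\<close>
    above the diagonal.\<close>
  define hh where "hh = (\<lambda>l. if l \<le> k then h (k - l) else 0)"
  have T: "toeplitz r h i (j + r * l) = hh l" for l
    using r assms by (auto simp: toeplitz_def i hh_def simp flip: diff_mult_distrib2)
  have T': "toeplitz r h (i + r) j = h (Suc k)"
    using r assms by (auto simp: toeplitz_def i)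
  have C: "shift_col r y (toeplitz r h) i (j + r * l) = hh l + (if l = 0 then 0 else y * hh (l - 1))" for l
  proof (cases l)
    case 0
    then show ?thesis using assms T[of 0] by (simp add: shift_col_def)
  next
    case (Suc l')
    have "j + r * Suc l' - r = j + r * l'" by simp
    then show ?thesis using T[of l] T[of l'] Suc by (simp add: shift_col_def)
  qed
  \<comment> \<open>This vanishing coefficient lets the shifted sum be reindexed without a boundary
    term.\<close>
  have Gn: "G y (Suc n) = 0" by (simp add: G_def en)
  have "(\<Sum>l\<le>n. G y l * (if l = 0 then 0 else y * hh (l - 1))) =
      (\<Sum>l\<le>Suc n. G y l * (if l = 0 then 0 else y * hh (l - 1)))" by (simp add: Gn)
  also have "\<dots> = (\<Sum>l\<le>n. y * G y (Suc l) * hh l)"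
    by (subst sum.atMost_Suc_shift) (simp add: mult_ac)
  finally have "(\<Sum>l\<le>n. G y l * shift_col r y (toeplitz r h) i (j + r * l)) =
      (\<Sum>l\<le>n. (G y l + y * G y (Suc l)) * hh l)"
    unfolding C by (simp add: distrib_left distrib_right sum.distrib)
  also have "\<dots> = (\<Sum>l\<le>n. of_bool (l = 0) * hh l) - y * (\<Sum>l\<le>n. \<epsilon> (Suc l) * hh l)"
    unfolding G_rec by (simp add: left_diff_distrib right_diff_distrib sum_subtractf sum_distrib_left mult_ac del: sum_of_bool_mult_eq sum_mult_of_bool_eq)
  also have "(\<Sum>l\<le>n. of_bool (l = 0) * hh l) = h k"
    by (subst sum.remove[of _ 0]) (auto simp: hh_def intro!: sum.neutral)
  also have "(\<Sum>l\<le>n. \<epsilon> (Suc l) * hh l) = (\<Sum>l\<le>k + n. \<epsilon> (Suc l) * hh l)"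
    by (rule sum.mono_neutral_left) (auto simp: en)
  also have "\<dots> = (\<Sum>l\<le>k. \<epsilon> (Suc l) * h (k - l))"
    by (rule sum.mono_neutral_cong_right) (auto simp: hh_def)
  also have "\<dots> = - h (Suc k)"
    using he[of "Suc k"] by (simp only: sum.atMost_Suc_shift) (simp add: e0 eq_neg_iff_add_eq_0 add.commute)
  finally show ?thesis
    using T[of 0] T' by (simp add: shift_row_def hh_def)
qed

end

context toeplitz_pair begin

text \<open>A Toeplitz entry is unchanged when row and column both move by \<open>r\<close>, so only
  the first \<open>r\<close> columns see on which side the factor stands.\<close>

lemma toeplitz_shift_high:
  assumes "r \<le> j"
  shows "shift_row r y (toeplitz r h) i j = shift_col r y (toeplitz r h) i j"
proof -
  obtain l where j: "j = l + r" using assms by (metis le_add_diff_inverse2)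
  have "toeplitz r h (i + r) (l + r) = toeplitz r h i l"
    by (simp add: toeplitz_def)
  then show ?thesis by (simp add: shift_row_def shift_col_def j)
qed

text \<open>The first \<open>r\<close> columns are scaled by \<open>E y\<close> and receive
  multiples of columns in \<open>{r..<r * Suc n}\<close>. The bound on \<open>N\<close> puts all of
  these into every low set, so each minor changes by \<open>E y ^ r\<close>.\<close>

lemma fock_trace_commute:
  assumes N: "N \<ge> m + r * Suc n"
  shows "fock_trace N m (foldr (shift_row r) ys (shift_row r y (toeplitz r h))) =
    E y ^ r * fock_trace N m (foldr (shift_row r) ys (shift_col r y (toeplitz r h)))"
proof -
  define M where "M = foldr (shift_row r) ys (shift_col r y (toeplitz r h))"
  \<comment> \<open>The relation involves only columns \<open>j + r * l\<close>; zeros extend it to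
    the whole block, as \<open>minor_column_combination\<close> requires.\<close>
  define w where "w = (\<lambda>j k. if k mod r = j then G y (k div r) else 0)"
  have low: "foldr (shift_row r) ys (shift_row r y (toeplitz r h)) i j =
      E y * M i j + (\<Sum>k\<in>{r..<r * Suc n}. w j k * M i k)" if "j < r" for i j
  proof -
    have "foldr (shift_row r) ys (shift_row r y (toeplitz r h)) i j = (\<Sum>l\<le>n. G y l * M i (j + r * l))"
      unfolding M_def
      by (rule shift_row_linear) (rule toeplitz_column_relation[OF that])
    also have "\<dots> = G y 0 * M i j + (\<Sum>l\<in>{1..n}. G y l * M i (j + r * l))"
      by (subst sum.remove[of _ 0]) (auto intro!: sum.cong)
    also have "(\<Sum>l\<in>{1..n}. G y l * M i (j + r * l)) = (\<Sum>k\<in>(\<lambda>l. j + r * l) ` {1..n}. w j k * M i k)"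
      using r that by (subst sum.reindex) (auto simp: inj_on_def w_def)
    also have "\<dots> = (\<Sum>k\<in>{r..<r * Suc n}. w j k * M i k)"
    proof (rule sum.mono_neutral_left)
      show "(\<lambda>l. j + r * l) ` {1..n} \<subseteq> {r..<r * Suc n}"
      proof
        fix k assume "k \<in> (\<lambda>l. j + r * l) ` {1..n}"
        then obtain l where l: "k = j + r * l" "l \<in> {1..n}" by blast
        have "r * 1 \<le> r * l" "r * l \<le> r * n" using l(2) by (intro mult_le_mono2; simp)+
        then show "k \<in> {r..<r * Suc n}"
          using that unfolding l(1) atLeastLessThan_iff mult_Suc_right by linarith
      qed
      show "\<forall>k\<in>{r..<r * Suc n} - (\<lambda>l. j + r * l) ` {1..n}. w j k * M i k = 0"
      proof
        fix k assume k: "k \<in> {r..<r * Suc n} - (\<lambda>l. j + r * l) ` {1..n}"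
        have "k mod r \<noteq> j"
        proof
          assume "k mod r = j"
          then have kk: "k = j + r * (k div r)" by auto
          have "1 \<le> k div r" "k div r < Suc n"
            using k r by (auto simp: Suc_le_eq div_greater_zero_iff less_mult_imp_div_less mult.commute)
          then have "k \<in> (\<lambda>l. j + r * l) ` {1..n}" using kk by (intro image_eqI[of _ _ "k div r"]) auto
          then show False using k by simp
        qed
        then show "w j k * M i k = 0" by (simp add: w_def)
      qed
    qed simp
    finally show ?thesis by (simp add: G_0)
  qed
  have high: "foldr (shift_row r) ys (shift_row r y (toeplitz r h)) i j = M i j" if "r \<le> j" for i j
    unfolding M_def
    using shift_row_linear[where A = "shift_row r y (toeplitz r h)" and I = "{()}" and c = "\<lambda>_. 1"
        and M = "shift_col r y (toeplitz r h)" and f = "\<lambda>_. j"]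
      toeplitz_shift_high[OF that] by simp
  have "minor B (foldr (shift_row r) ys (shift_row r y (toeplitz r h))) = E y ^ r * minor B M"
    if B: "B \<in> low_sets N m" for B
  proof -
    have sub: "{..<r * Suc n} \<subseteq> B"
      using low_sets_lower[OF B] N by auto
    have "minor B (foldr (shift_row r) ys (shift_row r y (toeplitz r h))) =
        minor B (\<lambda>i j. if j \<in> {..<r} then E y * M i j + (\<Sum>k\<in>{r..<r * Suc n}. w j k * M i k) else M i j)"
      using low high by (intro minor_cong) auto
    also have "\<dots> = E y ^ card {..<r} * minor B M"
      using sub B by (intro minor_column_combination) (auto simp: low_sets_def)
    finally show ?thesis by simp
  qed
  then show ?thesis
    by (simp add: fock_trace_def M_def sum_distrib_left mult_ac)
qed

section \<open>Rotating the factors around the trace\<close>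

definition F :: "nat \<Rightarrow> nat \<Rightarrow> complex fps list \<Rightarrow> complex fps" where
  "F N m ys = fock_trace N m (foldr (shift_row r) ys (toeplitz r h))"

text \<open>The innermost factor passes the Toeplitz matrix at the cost \<open>E y ^ r\<close>,
  stands at the right end, and returns cyclically to the front with \<open>y q^r\<close>.\<close>

lemma F_rotate1:
  assumes N: "N \<ge> m + r * Suc n"
  shows "agree (\<Sum>{..<N} + m) (F N m (ys @ [y])) (E y ^ r * F N m (y * fps_X ^ r # ys))"
proof -
  have "F N m (ys @ [y]) = E y ^ r * fock_trace N m (shift_col r y (foldr (shift_row r) ys (toeplitz r h)))"
    unfolding F_def using fock_trace_commute[OF N] by (simp add: foldr_shift_commute)
  also have "agree (\<Sum>{..<N} + m) \<dots> (E y ^ r * F N m (y * fps_X ^ r # ys))"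
    unfolding F_def foldr_Cons o_apply by (intro agree_mult agree_refl fock_trace_cyclic r)
  finally show ?thesis .
qed

lemma F_rotate:
  assumes N: "N \<ge> m + r * Suc n"
  shows "agree (\<Sum>{..<N} + m) (F N m (as @ ys))
    ((\<Prod>y\<leftarrow>ys. E y ^ r) * F N m (map (\<lambda>y. y * fps_X ^ r) ys @ as))"
proof (induction ys arbitrary: as rule: rev_induct)
  case (snoc y ys)
  have "agree (\<Sum>{..<N} + m) (F N m (as @ ys @ [y])) (E y ^ r * F N m ((y * fps_X ^ r # as) @ ys))"
    using F_rotate1[OF N, of "as @ ys" y] by simp
  also have "agree (\<Sum>{..<N} + m) \<dots> (E y ^ r * ((\<Prod>y\<leftarrow>ys. E y ^ r) *
      F N m (map (\<lambda>y. y * fps_X ^ r) ys @ (y * fps_X ^ r # as))))"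
    by (intro agree_mult agree_refl snoc)
  finally show ?case by (simp add: mult_ac)
qed simp

lemma F_rotate_iterate:
  assumes N: "N \<ge> m + r * Suc n"
  shows "agree (\<Sum>{..<N} + m) (F N m ys)
    ((\<Prod>s<S. \<Prod>y\<leftarrow>ys. E (y * fps_X ^ (r * s)) ^ r) * F N m (map (\<lambda>y. y * fps_X ^ (r * S)) ys))"
proof (induction S)
  case (Suc S)
  let ?ys = "map (\<lambda>y. y * fps_X ^ (r * S)) ys"
  note Suc
  also have "agree (\<Sum>{..<N} + m)
      ((\<Prod>s<S. \<Prod>y\<leftarrow>ys. E (y * fps_X ^ (r * s)) ^ r) * F N m ?ys)
      ((\<Prod>s<S. \<Prod>y\<leftarrow>ys. E (y * fps_X ^ (r * s)) ^ r) *
        ((\<Prod>y\<leftarrow>?ys. E y ^ r) * F N m (map (\<lambda>y. y * fps_X ^ r) ?ys)))"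
    using F_rotate[OF N, of "[]" ?ys] by (intro agree_mult agree_refl) simp
  finally show ?case
    by (simp add: o_def mult_ac power_add)
qed simp

text \<open>When all \<open>y\<close> vanish to the given precision the row shifts disappear, and a
  unitriangular Toeplitz matrix has all principal minors 1.\<close>

lemma F_high:
  assumes "\<And>y. y \<in> set ys \<Longrightarrow> agree k y 0"
  shows "agree k (F N m ys) (\<Sum>B\<in>low_sets N m. fps_X ^ \<Sum>B)"
proof -
  have "agree k (foldr (shift_row r) ys (toeplitz r h) i j) (toeplitz r h i j)" for i j
    using assms
  proof (induction ys arbitrary: i j)
    case (Cons y ys)
    have "agree k (foldr (shift_row r) ys (toeplitz r h) i j +
          y * foldr (shift_row r) ys (toeplitz r h) (i + r) j)
        (toeplitz r h i j + 0 * foldr (shift_row r) ys (toeplitz r h) (i + r) j)"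
      using Cons by (intro agree_add agree_mult agree_refl) auto
    then show ?case by (simp add: shift_row_def[of r y])
  qed simp
  then have "agree k (F N m ys) (\<Sum>B\<in>low_sets N m. fps_X ^ \<Sum>B * minor B (toeplitz r h))"
    unfolding F_def fock_trace_def by (intro agree_sum agree_mult agree_refl agree_minor)
  also have "\<dots> = (\<Sum>B\<in>low_sets N m. fps_X ^ \<Sum>B)"
    by (intro sum.cong refl) (simp add: minor_toeplitz h0 low_sets_def)
  finally show ?thesis .
qed

lemma fock_trace_shift_cols:
  "agree (\<Sum>{..<N} + m) (fock_trace N m (foldr (shift_col r) ys (foldr (shift_row r) as (toeplitz r h))))
    (F N m (map (\<lambda>y. y * fps_X ^ r) (rev ys) @ as))"
proof (induction ys arbitrary: as)
  case (Cons y ys)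
  have "agree (\<Sum>{..<N} + m)
      (fock_trace N m (foldr (shift_col r) (y # ys) (foldr (shift_row r) as (toeplitz r h))))
      (fock_trace N m (foldr (shift_col r) ys (foldr (shift_row r) (y * fps_X ^ r # as) (toeplitz r h))))"
    using fock_trace_cyclic[OF r, of N m y "foldr (shift_col r) ys (foldr (shift_row r) as (toeplitz r h))"]
    by (simp add: foldr_shift_commute)
  also note Cons
  finally show ?case by simp
qed (simp add: F_def)

text \<open>After this many rounds the letters are divisible by a power of \<open>q\<close> beyond
  the precision, and \<open>F_high\<close> applies. The product starts at \<open>s = 1\<close>
  because the first passage from right to left already brings one \<open>q^r\<close>.\<close>

theorem fock_trace_product:
  assumes N: "N \<ge> m + r * Suc n"
  shows "agree (\<Sum>{..<N} + m) (fock_trace N m (foldr (shift_col r) ys (toeplitz r h)))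
    ((\<Prod>s\<in>{1..Suc (\<Sum>{..<N} + m)}. \<Prod>y\<leftarrow>ys. E (y * fps_X ^ (r * s)) ^ r) *
      (\<Sum>B\<in>low_sets N m. fps_X ^ \<Sum>B))"
proof -
  let ?n = "\<Sum>{..<N} + m"
  define zs where "zs = map (\<lambda>y. y * fps_X ^ r) (rev ys)"
  have "agree ?n (fock_trace N m (foldr (shift_col r) ys (toeplitz r h))) (F N m zs)"
    using fock_trace_shift_cols[of N m ys "[]"] by (simp add: zs_def)
  also have "agree ?n (F N m zs) ((\<Prod>s<Suc ?n. \<Prod>y\<leftarrow>zs. E (y * fps_X ^ (r * s)) ^ r) *
      F N m (map (\<lambda>y. y * fps_X ^ (r * Suc ?n)) zs))"
    by (rule F_rotate_iterate[OF N])
  also have "agree ?n \<dots> ((\<Prod>s<Suc ?n. \<Prod>y\<leftarrow>zs. E (y * fps_X ^ (r * s)) ^ r) *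
      (\<Sum>B\<in>low_sets N m. fps_X ^ \<Sum>B))"
  proof (intro agree_mult agree_refl F_high)
    fix y assume "y \<in> set (map (\<lambda>y. y * fps_X ^ (r * Suc ?n)) zs)"
    then obtain z where y: "y = fps_X ^ (r * Suc ?n) * z" by (auto simp: mult.commute)
    have "?n < 1 * Suc ?n" by simp
    also have "1 * Suc ?n \<le> r * Suc ?n" using r by (intro mult_le_mono) auto
    finally show "agree ?n y 0" unfolding y by (rule agree_X_power_0)
  qed
  also have "(\<Prod>s<Suc ?n. \<Prod>y\<leftarrow>zs. E (y * fps_X ^ (r * s)) ^ r) =
      (\<Prod>s<Suc ?n. \<Prod>y\<leftarrow>ys. E (y * fps_X ^ (r * Suc s)) ^ r)"
    by (simp add: zs_def rev_map[symmetric] o_def prod_list.rev power_add mult_ac)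
  also have "\<dots> = (\<Prod>s\<in>{1..Suc ?n}. \<Prod>y\<leftarrow>ys. E (y * fps_X ^ (r * s)) ^ r)"
    by (rule prod.reindex_bij_witness[of _ "\<lambda>s. s - 1" Suc]) auto
  finally show ?thesis .
qed

end

section \<open>Specialization to finitely many letters\<close>

lemma sum_fps_const: "(\<Sum>x\<in>A. fps_const (f x)) = fps_const (\<Sum>x\<in>A. f x)"
  by (induction A rule: infinite_finite_induct) auto

lemma prod_fps_const: "(\<Prod>x\<in>A. fps_const (f x)) = fps_const (\<Prod>x\<in>A. f x)"
  by (induction A rule: infinite_finite_induct) auto

lemma minor_fps_const: "minor B (\<lambda>i j. fps_const (M i j)) = fps_const (minor B M)"
  unfolding minor_def prod_fps_const by (simp flip: fps_of_int sum_fps_const)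

lemma toeplitz_div:
  "toeplitz r h i j =
    (if i mod r = j mod r \<and> j div r \<le> i div r then h (i div r - j div r) else 0)"
proof (cases "i mod r = j mod r")
  case True
  define a b c where "a = i div r" and "b = j div r" and "c = j mod r"
  have ij: "i = r * a + c" "j = r * b + c"
    unfolding a_def b_def c_def using True by (metis mult_div_mod_eq)+
  have r0: "a = 0" "b = 0" if "r = 0" using that by (simp_all add: a_def b_def)
  have "i - j = r * (a - b)" by (simp add: ij diff_mult_distrib2)
  then have "(i - j) div r = a - b" using r0 by (cases "r = 0") auto
  moreover have "j \<le> i \<longleftrightarrow> b \<le> a" unfolding ij using r0 by (cases "r = 0") auto
  ultimately show ?thesis using True by (simp add: toeplitz_def flip: a_def b_def)
qed (simp add: toeplitz_def)

text \<open>Within a residue class this is the lower triangular matrix times the upper triangular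
  Toeplitz matrix of the polynomial with factors 1 + y x.\<close>

lemma foldr_shift_col_toeplitz:
  assumes r: "r \<ge> 1"
  shows "foldr (shift_col r) ys (toeplitz r h) i j =
    (if i mod r = j mod r then \<Sum>m\<le>min (i div r) (j div r).
      h (i div r - m) * coeff (\<Prod>y\<leftarrow>ys. [:1, y:]) (j div r - m) else 0)"
proof (induction ys arbitrary: j)
  case Nil
  show ?case
  proof (cases "i mod r = j mod r \<and> j div r \<le> i div r")
    case True
    then show ?thesis
      by (subst sum.remove[of _ "j div r"]) (auto simp: toeplitz_div intro!: sum.neutral)
  next
    case False
    then show ?thesis by (auto simp: toeplitz_div intro!: sum.neutral)
  qed
next
  case (Cons y ys)
  define P where "P = (\<Prod>y\<leftarrow>ys. [:1, y:])"
  define Q where "Q = (\<Prod>y\<leftarrow>y # ys. [:1, y:])"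
  have Q: "coeff Q k = coeff P k + (if k = 0 then 0 else y * coeff P (k - 1))" for k
    unfolding Q_def P_def by (cases k) simp_all
  show ?case
  proof (cases "r \<le> j")
    case False
    then show ?thesis
      unfolding Q_def[symmetric] by (simp add: shift_col_def[of r y] Cons Q P_def[symmetric])
  next
    case True
    then have j: "(j - r) mod r = j mod r" "(j - r) div r = j div r - 1" "j div r \<noteq> 0"
      using r by (auto simp: le_mod_geq le_div_geq div_greater_zero_iff)
    obtain l where l: "j div r = Suc l" using j(3) by (cases "j div r") auto
    show ?thesis
    proof (cases "i mod r = j mod r")
      case eq: True
      have "(\<Sum>m\<le>min (i div r) (Suc l). h (i div r - m) * (if Suc l - m = 0 then 0 else y * coeff P (Suc l - m - 1))) =
        (\<Sum>m\<le>min (i div r) l. h (i div r - m) * (y * coeff P (l - m)))"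
        by (rule sum.mono_neutral_cong_right) auto
      then show ?thesis
        using True j eq unfolding Q_def[symmetric]
        by (simp add: shift_col_def[of r y] Cons Q P_def[symmetric] l distrib_left
          sum.distrib sum_distrib_left mult_ac)
    next
      case False
      then show ?thesis
        using True j by (simp add: shift_col_def[of r y] Cons)
    qed
  qed
qed

definition exact_sets :: "nat \<Rightarrow> nat \<Rightarrow> nat set set" where
  "exact_sets N m = {B. finite B \<and> card B = N \<and> \<Sum>B = \<Sum>{..<N} + m}"

section \<open>The case where \<open>u\<close> is a power of \<open>p\<close>\<close>

context generic_base begin

lemma qh_0 [simp]: "qh p u 0 = 1"
  by (simp add: qh_def)

text \<open>This is the \<open>q\<close>-binomial theorem in recursive form.\<close>

lemma qh_rec: "qh p (u * p) (Suc k) - u * qh p (u * p) k = qh p u (Suc k)"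
proof -
  have "1 - p * p ^ k \<noteq> 0" using p1'[of k] by simp
  then show ?thesis
    unfolding qh_def qpoch_Suc_shift[of p u k] qpoch_Suc[of p "u * p" k] qpoch_Suc[of p p k]
    by (simp add: divide_simps) (simp add: algebra_simps)
qed

text \<open>The outer variable stands for \<open>w^r\<close>; the coefficients are constant series
  in \<open>q\<close>.\<close>

definition qh_series :: "complex \<Rightarrow> complex fps fps" where
  "qh_series u = Abs_fps (\<lambda>k. fps_const (qh p u k))"

definition letters :: "nat \<Rightarrow> complex fps poly" where
  "letters n = (\<Prod>i<n. [:1, fps_const (- (p ^ i)):])"

text \<open>By \<open>qh_rec\<close>, multiplying by 1 - p^n x turns the series at
  \<open>p^(n+1)\<close> into the one at \<open>p^n\<close>, and the series at 1 is trivial.\<close>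

lemma letters_inverse: "fps_of_poly (letters n) * qh_series (p ^ n) = 1"
proof (induction n)
  case 0
  have "qh p 1 k = of_bool (k = 0)" for k
    by (cases k) (auto simp: qh_def qpoch_Suc_shift)
  then have "qh_series 1 = 1"
    by (intro fps_ext) (simp add: qh_series_def)
  then show ?case by (simp add: letters_def)
next
  case (Suc n)
  have "fps_of_poly [:1, fps_const (- (p ^ n)):] * qh_series (p ^ n * p) = qh_series (p ^ n)"
  proof (rule fps_ext)
    fix k show "fps_nth (fps_of_poly [:1, fps_const (- (p ^ n)):] * qh_series (p ^ n * p)) k =
        fps_nth (qh_series (p ^ n)) k"
    proof (cases k)
      case (Suc l)
      then show ?thesis
        unfolding fps_of_poly_pCons Suc
        by (simp add: distrib_right mult.assoc qh_series_def fps_mult_fps_X_commute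
          qh_rec[of "p ^ n" l, symmetric] del: power_Suc)
    qed (simp add: qh_series_def)
  qed
  moreover have "letters (Suc n) = letters n * [:1, fps_const (- (p ^ n)):]"
    unfolding letters_def by (rule prod.lessThan_Suc)
  ultimately show ?case
    using Suc by (simp only: fps_of_poly_mult mult.assoc power_Suc2)
qed

lemma degree_letters: "degree (letters n) \<le> n"
proof -
  have "degree (letters n) \<le> (\<Sum>i<n. degree [:1, fps_const (- (p ^ i)):])"
    unfolding letters_def by (rule degree_prod_sum_le[unfolded o_def]) auto
  also have "\<dots> \<le> (\<Sum>i<n. 1)" by (intro sum_mono) simp
  finally show ?thesis by simp
qed

lemma toeplitz_pair_letters:
  assumes "r \<ge> 1"
  shows "toeplitz_pair r n (\<lambda>k. fps_const (qh p (p ^ n) k)) (coeff (letters n))"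
proof
  have "fps_nth (fps_of_poly (letters n) * qh_series (p ^ n)) k = of_bool (k = 0)" for k
    by (simp add: letters_inverse)
  then have *: "(\<Sum>l\<le>k. coeff (letters n) l * fps_const (qh p (p ^ n) (k - l))) = of_bool (k = 0)" for k
    by (simp add: fps_mult_nth qh_series_def atLeast0AtMost)
  show "coeff (letters n) 0 = 1" using *[of 0] by simp
  show "\<And>k. k > n \<Longrightarrow> coeff (letters n) k = 0"
    using degree_letters[of n] by (intro coeff_eq_0) auto
  show "(\<Sum>l\<le>k. coeff (letters n) l * fps_const (qh p (p ^ n) (k - l))) = 0" if "k \<ge> 1" for k
    using *[of k] that by simp
qed (use assms in auto)

lemma E_letters:
  fixes r :: nat
  assumes "r \<ge> 1"
  shows "toeplitz_pair.E n (coeff (letters n)) y = (\<Prod>i<n. 1 + fps_const (p ^ i) * y)"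
proof -
  have "toeplitz_pair.E n (coeff (letters n)) y = (\<Sum>i\<le>n. coeff (letters n) i * (- y) ^ i)"
    unfolding toeplitz_pair.E_def[OF toeplitz_pair_letters[OF assms, of n]] by (simp add: mult.commute)
  also have "\<dots> = poly (letters n) (- y)"
    unfolding poly_altdef using degree_letters[of n]
    by (intro sum.mono_neutral_right) (auto simp: coeff_eq_0)
  also have "\<dots> = (\<Prod>i<n. 1 + fps_const (p ^ i) * y)"
    by (simp add: letters_def poly_prod mult.commute flip: fps_const_neg)
  finally show ?thesis .
qed

text \<open>The finite q-binomial theorem; the right hand side is the upper triangular factor of
  \<open>kernel1\<close> at \<open>u = p^n\<close>.\<close>

lemma coeff_dual_letters:
  "coeff (\<Prod>i<n. [:1, fps_const (- ((1 / p) ^ i)):]) k = fps_const (p ^ k * qh p (1 / p ^ n) k)"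
proof (induction n arbitrary: k)
  case 0
  have "qh p 1 k = of_bool (k = 0)" for k
    by (cases k) (auto simp: qh_def qpoch_Suc_shift)
  then show ?case by simp
next
  case (Suc n)
  have "qh p (1 / p ^ Suc n * p) (Suc l) - 1 / p ^ Suc n * qh p (1 / p ^ Suc n * p) l = qh p (1 / p ^ Suc n) (Suc l)" for l
    by (rule qh_rec)
  then have rec: "qh p (1 / p ^ Suc n) (Suc l) = qh p (1 / p ^ n) (Suc l) - 1 / p ^ Suc n * qh p (1 / p ^ n) l" for l
    using p0 by simp
  show ?case
  proof (cases k)
    case 0
    then show ?thesis using Suc[of 0] by (simp add: mult.commute[of "prod _ _"])
  next
    case (Suc l)
    have "coeff (\<Prod>i<Suc n. [:1, fps_const (- ((1 / p) ^ i)):]) k =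
        coeff (\<Prod>i<n. [:1, fps_const (- ((1 / p) ^ i)):]) (Suc l) -
        fps_const ((1 / p) ^ n) * coeff (\<Prod>i<n. [:1, fps_const (- ((1 / p) ^ i)):]) l"
      using Suc by (simp add: mult.commute[of "prod _ _"] flip: fps_const_neg)
    also have "\<dots> = fps_const (p ^ k * qh p (1 / p ^ Suc n) k)"
    proof -
      have "p ^ Suc l * (a - 1 / p ^ Suc n * b) = p ^ Suc l * a - (1 / p) ^ n * (p ^ l * b)" for a b
        using p0 by (simp add: divide_simps) (simp add: algebra_simps)
      then show ?thesis unfolding Suc.IH Suc rec by simp
    qed
    finally show ?thesis .
  qed
qed

definition dual_letters :: "nat \<Rightarrow> complex fps list" where
  "dual_letters n = map (\<lambda>i. fps_const (- ((1 / p) ^ i))) [0..<n]"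

lemma prod_list_dual_letters: "(\<Prod>y\<leftarrow>dual_letters n. f y) = (\<Prod>i<n. f (fps_const (- ((1 / p) ^ i))))"
  by (induction n) (simp_all add: dual_letters_def)

lemma kernel_letters:
  assumes "r \<ge> 1"
  shows "foldr (shift_col r) (dual_letters n) (toeplitz r (\<lambda>k. fps_const (qh p (p ^ n) k))) =
    (\<lambda>i j. fps_const (fock_kernel r p (p ^ n) i j))"
  by (auto simp: fun_eq_iff foldr_shift_col_toeplitz[OF assms] prod_list_dual_letters
    coeff_dual_letters fock_kernel_def kernel1_def simp flip: sum_fps_const)

text \<open>The factors \<open>E y ^ r\<close> collected by the rotation, at y = - p^(-j) q^(r
  s).\<close>

definition core_factor :: "nat \<Rightarrow> nat \<Rightarrow> nat \<Rightarrow> complex fps" where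
  "core_factor r n m =
    (\<Prod>s\<in>{1..m}. \<Prod>j<n. (\<Prod>i<n. 1 - fps_const (p ^ i / p ^ j) * fps_X ^ (r * s)) ^ r)"

lemma core_factor_agree:
  assumes "r \<ge> 1" "m \<le> S"
  shows "agree m (core_factor r n S) (core_factor r n m)"
proof -
  let ?f = "\<lambda>s. \<Prod>j<n. (\<Prod>i<n. 1 - fps_const (p ^ i / p ^ j) * fps_X ^ (r * s)) ^ r"
  have "core_factor r n S = prod ?f {1..m} * prod ?f {m + 1..S}"
    unfolding core_factor_def using assms(2) prod.ub_add_nat[of 1 m ?f "S - m"] by simp
  also have "agree m \<dots> (prod ?f {1..m} * (\<Prod>s\<in>{m + 1..S}. \<Prod>j<n. \<Prod>k<r. \<Prod>i<n. 1))"
    \<comment> \<open>The power is written as a product so that \<open>agree_prod\<close> reaches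
      its base.\<close>
    unfolding prod_constant[of _ "{..<r}", symmetric, unfolded card_lessThan]
  proof (intro agree_mult agree_refl agree_prod)
    fix s j i assume "s \<in> {m + 1..S}"
    then have "m < 1 * s" by simp
    also have "1 * s \<le> r * s" using assms by (intro mult_le_mono) auto
    finally have "agree m (fps_X ^ (r * s) * fps_const (- (p ^ i / p ^ j))) 0"
      by (rule agree_X_power_0)
    then have "agree m (1 + fps_X ^ (r * s) * fps_const (- (p ^ i / p ^ j))) (1 + 0)"
      by (intro agree_add agree_refl)
    then show "agree m (1 - fps_const (p ^ i / p ^ j) * fps_X ^ (r * s)) 1"
      by (simp add: mult.commute flip: fps_const_neg)
  qed
  finally show ?thesis by (simp add: core_factor_def)
qed

text \<open>Compare coefficients of \<open>q^(?c + m)\<close> in \<open>fock_trace_product\<close>,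
  where \<open>?c\<close> is the lowest energy. On the left only sets of excess energy
  \<open>m\<close> remain; on the right a set of excess \<open>m - k\<close> leaves degree
  \<open>k\<close> to \<open>core_factor\<close>.\<close>

lemma sum_minors_core:
  assumes r: "r \<ge> 1" and N: "N \<ge> m + r * Suc n"
  shows "(\<Sum>B\<in>exact_sets N m. minor B (fock_kernel r p (p ^ n))) =
    (\<Sum>k\<le>m. fps_nth (core_factor r n m) k * of_nat (card (exact_sets N (m - k))))"
proof -
  let ?c = "\<Sum>{..<N}"
  define S where "S = Suc (?c + m)"
  have exact_low: "exact_sets N m \<subseteq> low_sets N m" for m by (auto simp: exact_sets_def low_sets_def)
  have coeff: "fps_nth (fps_X ^ e * fps_const a) k = (if e = k then a else 0)" for e k and a :: complex
    by (auto simp: fps_X_power_mult_nth)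
  define K where "K = fock_trace N m (foldr (shift_col r) (dual_letters n) (toeplitz r (\<lambda>k. fps_const (qh p (p ^ n) k))))"
  have "K = (\<Sum>B\<in>low_sets N m. fps_X ^ (\<Sum>B) * fps_const (minor B (fock_kernel r p (p ^ n))))"
    unfolding K_def kernel_letters[OF r] fock_trace_def minor_fps_const ..
  then have "fps_nth K (?c + m) = (\<Sum>B\<in>low_sets N m. if (\<Sum>B) = ?c + m then minor B (fock_kernel r p (p ^ n)) else 0)"
    by (simp only: fps_sum_nth coeff)
  also have "\<dots> = (\<Sum>B\<in>exact_sets N m. minor B (fock_kernel r p (p ^ n)))"
  proof (rule sum.mono_neutral_cong_right)
    show "exact_sets N m \<subseteq> low_sets N m" by (rule exact_low)
  next
    show "finite (low_sets N m)" by simp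
  qed (auto simp: exact_sets_def low_sets_def)
  finally have "(\<Sum>B\<in>exact_sets N m. minor B (fock_kernel r p (p ^ n))) = fps_nth K (?c + m)"
    by (rule sym)
  also have "\<dots> = fps_nth ((\<Prod>s\<in>{1..S}. \<Prod>y\<leftarrow>dual_letters n.
        toeplitz_pair.E n (coeff (letters n)) (y * fps_X ^ (r * s)) ^ r) *
        (\<Sum>B\<in>low_sets N m. fps_X ^ (\<Sum>B))) (?c + m)"
    unfolding K_def S_def
    by (rule agreeD[OF toeplitz_pair.fock_trace_product[OF toeplitz_pair_letters[OF r] N] order_refl])
  also have "(\<Prod>s\<in>{1..S}. \<Prod>y\<leftarrow>dual_letters n.
        toeplitz_pair.E n (coeff (letters n)) (y * fps_X ^ (r * s)) ^ r) = core_factor r n S"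
    unfolding core_factor_def E_letters[OF r] prod_list_dual_letters
    by (intro prod.cong refl arg_cong2[where f = "(^)"])
      (simp add: mult.assoc[symmetric] power_one_over flip: fps_const_neg)
  also have "fps_nth (core_factor r n S * (\<Sum>B\<in>low_sets N m. fps_X ^ (\<Sum>B))) (?c + m) =
      (\<Sum>B\<in>low_sets N m. fps_nth (core_factor r n S) (?c + m - (\<Sum>B)))"
    by (auto simp: sum_distrib_left fps_sum_nth fps_X_power_mult_right_nth low_sets_def intro!: sum.cong)
  also have "\<dots> = (\<Sum>k\<le>m. \<Sum>B | B \<in> low_sets N m \<and> ?c + m - (\<Sum>B) = k. fps_nth (core_factor r n S) (?c + m - (\<Sum>B)))"
  proof (rule sum.group[symmetric])
    have "?c + m - \<Sum>B \<le> m" if "B \<in> low_sets N m" for B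
      using sum_lessThan_card_le[of B] that unfolding low_sets_def by auto
    then show "(\<lambda>B. ?c + m - \<Sum>B) ` low_sets N m \<subseteq> {..m}" by blast
  qed simp_all
  also have "\<dots> = (\<Sum>k\<le>m. fps_nth (core_factor r n m) k * of_nat (card (exact_sets N (m - k))))"
  proof (intro sum.cong refl)
    fix k assume k: "k \<in> {..m}"
    have "{B \<in> low_sets N m. ?c + m - (\<Sum>B) = k} = exact_sets N (m - k)"
      using k by (auto simp: low_sets_def exact_sets_def)
    then have "(\<Sum>B | B \<in> low_sets N m \<and> ?c + m - (\<Sum>B) = k. fps_nth (core_factor r n S) (?c + m - (\<Sum>B))) =
        (\<Sum>B\<in>exact_sets N (m - k). fps_nth (core_factor r n S) k)"
      by (intro sum.cong) auto
    also have "fps_nth (core_factor r n S) k = fps_nth (core_factor r n m) k"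
      using core_factor_agree[OF r, of m S n] k by (simp add: agree_def S_def)
    finally show "(\<Sum>B | B \<in> low_sets N m \<and> ?c + m - (\<Sum>B) = k. fps_nth (core_factor r n S) (?c + m - (\<Sum>B))) =
        fps_nth (core_factor r n m) k * of_nat (card (exact_sets N (m - k)))"
      by simp
  qed
  finally show ?thesis .
qed

end

section \<open>Beta numbers and hooks\<close>

text \<open>Padded by zeros, so that a partition can be read as having \<open>N\<close>
  rows.\<close>

definition part :: "nat list \<Rightarrow> nat \<Rightarrow> nat" where
  "part xs i = (if i < length xs then xs ! i else 0)"

definition conj_part :: "nat list \<Rightarrow> nat \<Rightarrow> nat" where
  "conj_part xs j = card {i. j < part xs i}"

definition beta :: "nat \<Rightarrow> nat list \<Rightarrow> nat set" where
  "beta N xs = (\<lambda>i. part xs i + (N - Suc i)) ` {..<N}"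

lemma part_antimono: "xs \<in> partitions \<Longrightarrow> i \<le> i' \<Longrightarrow> part xs i' \<le> part xs i"
  using sorted_wrt_nth_less[of "(\<ge>)" xs i i'] by (cases "i = i'") (auto simp: partitions_def part_def)

lemma downward_closed_eq_lessThan:
  fixes S :: "nat set"
  assumes "finite S" "\<And>i j. i \<in> S \<Longrightarrow> j \<le> i \<Longrightarrow> j \<in> S"
  shows "S = {..<card S}"
proof -
  obtain n where S: "S = {..<n}"
  proof (cases "S = {}")
    case True
    then show ?thesis using that[of 0] by simp
  next
    case False
    have "S = {..<Suc (Max S)}"
      using assms(1) assms(2)[OF Max_in[OF assms(1) False]] by (auto simp: less_Suc_eq_le)
    then show ?thesis by (rule that)
  qed
  then show ?thesis by simp
qed

lemma less_conj_part_iff: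
  assumes "xs \<in> partitions"
  shows "i < conj_part xs j \<longleftrightarrow> j < part xs i"
proof -
  have "{i. j < part xs i} \<subseteq> {..<length xs}" by (auto simp: part_def split: if_splits)
  then have "finite {i. j < part xs i}" by (rule finite_subset) simp
  moreover have "i' \<in> {i. j < part xs i}" if "i \<in> {i. j < part xs i}" "i' \<le> i" for i i'
    using that part_antimono[OF assms, of i' i] by auto
  ultimately have "{i. j < part xs i} = {..<conj_part xs j}"
    unfolding conj_part_def by (rule downward_closed_eq_lessThan)
  then show ?thesis by auto
qed

lemma conj_part_antimono: "j \<le> j' \<Longrightarrow> xs \<in> partitions \<Longrightarrow> conj_part xs j' \<le> conj_part xs j"
  using less_conj_part_iff[of xs "conj_part xs j" j] less_conj_part_iff[of xs "conj_part xs j" j']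
  by linarith

lemma conj_part_le_length: "xs \<in> partitions \<Longrightarrow> conj_part xs j \<le> length xs"
  using less_conj_part_iff[of xs "length xs" j] by (auto simp: part_def)

lemma ferrers_part: "ferrers xs = {(i, j). j < part xs i}"
  by (auto simp: ferrers_def part_def split: if_splits)

text \<open>The first summand counts the corner and the arm, the second the leg.\<close>

lemma card_hook:
  assumes xs: "xs \<in> partitions" and ij: "j < part xs i"
  shows "card (hook xs (i, j)) = part xs i - j + (conj_part xs j - Suc i)"
proof -
  have "hook xs (i, j) = Pair i ` {j..<part xs i} \<union> (\<lambda>i'. (i', j)) ` {Suc i..<conj_part xs j}"
    using ij less_conj_part_iff[OF xs] by (auto simp: hook_def ferrers_part image_iff)
  moreover have "Pair i ` {j..<part xs i} \<inter> (\<lambda>i'. (i', j)) ` {Suc i..<conj_part xs j} = {}"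
    by auto
  ultimately show ?thesis
    by (simp add: card_Un_disjoint card_image inj_on_def)
qed

context
  fixes xs :: "nat list" and N :: nat
  assumes xs: "xs \<in> partitions" and N: "length xs \<le> N"
begin

private definition "a i = part xs i + (N - Suc i)"
text \<open>The gap attached to column \<open>j\<close>; for a box (i, j) the difference
  \<open>a i - b j\<close> is its hook length.\<close>

private definition "b j = N + j - conj_part xs j"

lemma a_strict: "k < N \<Longrightarrow> k' < N \<Longrightarrow> a k' < a k \<longleftrightarrow> k < k'"
  using part_antimono[OF xs, of k k'] part_antimono[OF xs, of k' k]
  by (cases k k' rule: linorder_cases) (auto simp: a_def)

lemma inj_a: "inj_on a {..<N}"
  by (rule inj_onI) (metis a_strict lessThan_iff linorder_neqE_nat nat_neq_iff)

lemma beta_eq_image: "beta N xs = a ` {..<N}"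
  by (auto simp: beta_def a_def)

lemma finite_beta: "finite (beta N xs)" and card_beta: "card (beta N xs) = N"
  using inj_a by (simp_all add: beta_eq_image card_image)

lemma sum_beta: "\<Sum>(beta N xs) = \<Sum>{..<N} + sum_list xs"
proof -
  have "\<Sum>(beta N xs) = (\<Sum>i<N. part xs i) + (\<Sum>i<N. N - Suc i)"
    unfolding beta_eq_image sum.reindex[OF inj_a] by (simp only: a_def o_def sum.distrib)
  also have "(\<Sum>i<N. N - Suc i) = \<Sum>{..<N}"
    by (rule sum.nat_diff_reindex)
  also have "(\<Sum>i<N. part xs i) = (\<Sum>i<length xs. part xs i)"
    using N by (intro sum.mono_neutral_right) (auto simp: part_def)
  also have "\<dots> = sum_list xs"
    by (simp add: sum_list_sum_nth part_def lessThan_atLeast0)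
  finally show ?thesis by simp
qed

lemma card_beta_below:
  assumes "i < N" shows "card (beta N xs \<inter> {..<a i}) = N - Suc i"
proof -
  have "beta N xs \<inter> {..<a i} = a ` {Suc i..<N}"
    unfolding beta_eq_image using assms a_strict by (auto simp: Suc_le_eq)
  moreover have "inj_on a {Suc i..<N}" by (rule inj_on_subset[OF inj_a]) auto
  ultimately show ?thesis by (simp add: card_image)
qed

text \<open>\<open>b\<close> is strictly increasing and misses the beta numbers, since
  \<open>a k\<close> exceeds or falls below \<open>b j\<close> according to whether row
  \<open>k\<close> reaches column \<open>j\<close>. The image has the right size because
  \<open>N - Suc i\<close> of the numbers below \<open>a i\<close> are beta numbers.\<close>

lemma beta_complement:
  assumes i: "i < N"
  shows "bij_betw b {..<part xs i} ({..<a i} - beta N xs)"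
proof -
  have cN: "conj_part xs j \<le> N" for j using conj_part_le_length[OF xs, of j] N by simp
  have inj: "inj_on b A" for A
  proof (rule linorder_inj_onI)
    fix j j' :: nat assume "j < j'"
    then show "b j \<noteq> b j'"
      using conj_part_antimono[OF _ xs, of j j'] cN[of j] by (simp add: b_def)
  qed auto
  have sub: "b ` {..<part xs i} \<subseteq> {..<a i} - beta N xs"
  proof
    fix x assume "x \<in> b ` {..<part xs i}"
    then obtain j where j: "x = b j" "j < part xs i" by auto
    have "i < conj_part xs j" using j less_conj_part_iff[OF xs] by simp
    then have "b j < a i" using j i cN[of j] by (simp add: a_def b_def)
    moreover have "b j \<noteq> a k" if k: "k < N" for k
      using less_conj_part_iff[OF xs, of k j] k cN[of j]
      by (cases "k < conj_part xs j") (simp_all add: a_def b_def)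
    ultimately show "x \<in> {..<a i} - beta N xs"
      unfolding beta_eq_image using j by auto
  qed
  have "card ({..<a i} - beta N xs) = card {..<a i} - card (beta N xs \<inter> {..<a i})"
    using card_Diff_subset_Int[of "{..<a i}" "beta N xs"] by (simp add: Int_commute)
  also have "\<dots> = part xs i"
    unfolding card_beta_below[OF i] by (simp add: a_def)
  finally have "b ` {..<part xs i} = {..<a i} - beta N xs"
    using sub inj by (intro card_subset_eq) (auto simp: card_image)
  then show ?thesis using inj by (auto simp: bij_betw_def)
qed

lemma prod_hooks_beta:
  "(\<Prod>x\<in>beta N xs. \<Prod>y\<in>{..<x} - beta N xs. f (x - y)) = (\<Prod>c\<in>ferrers xs. f (card (hook xs c)))"
  for f :: "nat \<Rightarrow> complex"
proof -
  have "(\<Prod>x\<in>beta N xs. \<Prod>y\<in>{..<x} - beta N xs. f (x - y)) =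
      (\<Prod>i<N. \<Prod>y\<in>{..<a i} - beta N xs. f (a i - y))"
    by (subst beta_eq_image) (simp add: prod.reindex[OF inj_a])
  also have "\<dots> = (\<Prod>i<N. \<Prod>j<part xs i. f (card (hook xs (i, j))))"
  proof (rule prod.cong[OF refl])
    fix i assume "i \<in> {..<N}"
    then have i: "i < N" by simp
    have "(\<Prod>y\<in>{..<a i} - beta N xs. f (a i - y)) = (\<Prod>j<part xs i. f (a i - b j))"
      by (rule prod.reindex_bij_betw[symmetric, OF beta_complement[OF i]])
    also have "\<dots> = (\<Prod>j<part xs i. f (card (hook xs (i, j))))"
    proof (intro prod.cong refl arg_cong[where f = f])
      fix j assume "j \<in> {..<part xs i}"
      then have j: "j < part xs i" by simp
      then have "i < conj_part xs j" using less_conj_part_iff[OF xs] by simp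
      then show "a i - b j = card (hook xs (i, j))"
        using i j conj_part_le_length[OF xs, of j] N unfolding card_hook[OF xs j]
        by (simp add: a_def b_def)
    qed
    finally show "(\<Prod>y\<in>{..<a i} - beta N xs. f (a i - y)) = (\<Prod>j<part xs i. f (card (hook xs (i, j))))" .
  qed
  also have "\<dots> = (\<Prod>(i, j)\<in>(SIGMA i:{..<N}. {..<part xs i}). f (card (hook xs (i, j))))"
    by (rule prod.Sigma) auto
  also have "(SIGMA i:{..<N}. {..<part xs i}) = ferrers xs"
    using N by (auto simp: ferrers_part part_def split: if_splits)
  finally show ?thesis by (simp add: case_prod_unfold)
qed

text \<open>The rank of a beta number determines its row, so the set determines the
  partition.\<close>

lemma part_eq_beta:
  assumes "i < N" "x \<in> beta N xs" "card (beta N xs \<inter> {..<x}) = N - Suc i"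
  shows "part xs i + (N - Suc i) = x"
proof -
  obtain k where k: "k < N" "x = a k" using assms(2) by (auto simp: beta_eq_image)
  then have "k = i" using assms card_beta_below[OF k(1)] by simp
  then show ?thesis using k by (simp add: a_def)
qed

lemma beta_enum:
  assumes "i < N"
  shows "part xs i + (N - Suc i) \<in> beta N xs"
    "card (beta N xs \<inter> {..<part xs i + (N - Suc i)}) = N - Suc i"
  using card_beta_below[OF assms] assms by (auto simp: beta_def a_def)

end

section \<open>Bijection between partitions and sets of beta numbers\<close>

lemma length_le_sum_list: "xs \<in> partitions \<Longrightarrow> length xs \<le> sum_list xs"
proof (induction xs)
  case (Cons x xs)
  then have "xs \<in> partitions" "x \<noteq> 0" by (auto simp: partitions_def)
  then show ?case using Cons by auto
qed simp

lemma partitions_eqI: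
  assumes "xs \<in> partitions" "ys \<in> partitions" "\<And>i. part xs i = part ys i"
  shows "xs = ys"
proof -
  have *: "i < length zs \<longleftrightarrow> part zs i \<noteq> 0" if "zs \<in> partitions" for zs i
    using that by (auto simp: part_def partitions_def in_set_conv_nth)
  have "length xs = length ys"
    using *[OF assms(1)] *[OF assms(2)] assms(3) by (metis linorder_neqE_nat nat_neq_iff)
  then show ?thesis
    using assms(3) by (intro nth_equalityI) (auto simp: part_def split: if_splits, metis)
qed

lemma part_Cons: "part (x # xs) i = (case i of 0 \<Rightarrow> x | Suc k \<Rightarrow> part xs k)"
  by (cases i) (auto simp: part_def)

text \<open>In a decreasing list the zeros form a tail, which the padding of \<open>part\<close>
  makes invisible.\<close>

lemma part_filter_nonzero:
  assumes "sorted_wrt (\<ge>) zs"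
  shows "part (filter (\<lambda>x. x \<noteq> 0) zs) i = part zs i"
  using assms
proof (induction zs arbitrary: i)
  case (Cons z zs)
  show ?case
  proof (cases "z = 0")
    case True
    then have zero: "\<forall>x\<in>set zs. x = 0" using Cons.prems by auto
    then have "filter (\<lambda>x. x \<noteq> 0) (z # zs) = []" using True by (simp add: filter_empty_conv)
    moreover have "part (z # zs) i = 0"
      using zero True by (auto simp: part_def nth_Cons split: nat.split)
    ultimately show ?thesis by (simp add: part_def)
  next
    case False
    then have "filter (\<lambda>x. x \<noteq> 0) (z # zs) = z # filter (\<lambda>x. x \<noteq> 0) zs" by simp
    then show ?thesis
      using Cons by (simp only: part_Cons sorted_wrt.simps)
  qed
qed (simp add: part_def)

text \<open>Ranks give injectivity. For surjectivity subtract \<open>k\<close> from the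
  \<open>k\<close>-th smallest element (from 0), reverse, and drop zeros. Since
  \<open>m \<le> N\<close>, no partition of \<open>m\<close> has more than \<open>N\<close>
  rows.\<close>

lemma bij_betw_beta:
  assumes N: "m \<le> N"
  shows "bij_betw (beta N) {xs \<in> partitions. sum_list xs = m} (exact_sets N m)"
proof (rule bij_betwI')
  fix xs ys assume "xs \<in> {xs \<in> partitions. sum_list xs = m}" "ys \<in> {xs \<in> partitions. sum_list xs = m}"
  then have xs: "xs \<in> partitions" "length xs \<le> N" and ys: "ys \<in> partitions" "length ys \<le> N"
    using N length_le_sum_list by fastforce+
  show "beta N xs = beta N ys \<longleftrightarrow> xs = ys"
  proof
    assume eq: "beta N xs = beta N ys"
    show "xs = ys"
    proof (rule partitions_eqI[OF xs(1) ys(1)])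
      fix i show "part xs i = part ys i"
      proof (cases "i < N")
        case True
        show ?thesis
          using part_eq_beta[OF xs True, of "part ys i + (N - Suc i)"] beta_enum[OF ys True] eq by simp
      next
        case False
        then show ?thesis using xs ys by (simp add: part_def)
      qed
    qed
  qed simp
next
  fix xs assume "xs \<in> {xs \<in> partitions. sum_list xs = m}"
  then have xs: "xs \<in> partitions" "length xs \<le> N" "sum_list xs = m"
    using N length_le_sum_list by fastforce+
  then show "beta N xs \<in> exact_sets N m"
    by (simp add: exact_sets_def finite_beta card_beta sum_beta)
next
  fix B assume "B \<in> exact_sets N m"
  then have B: "finite B" "card B = N" "\<Sum>B = \<Sum>{..<N} + m" by (auto simp: exact_sets_def)
  define l where "l = sorted_list_of_set B"
  have l: "length l = N" "set l = B" "sorted_wrt (<) l" using B by (auto simp: l_def)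
  have step: "l ! k + (k' - k) \<le> l ! k'" if "k \<le> k'" "k' < N" for k k'
    using that
  proof (induction k' rule: dec_induct)
    case (step n)
    then have "l ! n < l ! Suc n" using l sorted_wrt_nth_less[OF l(3), of n "Suc n"] by simp
    then show ?case using step by simp
  qed simp
  define zs where "zs = map (\<lambda>i. l ! (N - Suc i) - (N - Suc i)) [0..<N]"
  define xs where "xs = filter (\<lambda>x. x \<noteq> 0) zs"
  have nth_ge: "k \<le> l ! k" if "k < N" for k using step[of 0 k] that by simp
  have mono: "l ! k - k \<le> l ! k' - k'" if "k \<le> k'" "k' < N" for k k'
    using step[OF that] nth_ge[of k] nth_ge[of k'] that by linarith
  have zs_le: "zs ! j \<le> zs ! i" if "i < j" "j < N" for i j
    using that mono[of "N - Suc j" "N - Suc i"] by (simp add: zs_def)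
  then have sorted: "sorted_wrt (\<ge>) zs"
    by (auto simp: sorted_wrt_iff_nth_less zs_def)
  have xs: "xs \<in> partitions"
    using sorted by (auto simp: partitions_def xs_def sorted_wrt_filter)
  have len: "length xs \<le> N"
    unfolding xs_def using length_filter_le[of "\<lambda>x. x \<noteq> 0" zs] by (simp add: zs_def)
  have "part xs i + (N - Suc i) = l ! (N - Suc i)" if "i < N" for i
    using that nth_ge[of "N - Suc i"] unfolding xs_def part_filter_nonzero[OF sorted]
    by (simp add: part_def zs_def)
  then have "beta N xs = (\<lambda>i. l ! (N - Suc i)) ` {..<N}"
    unfolding beta_def by (intro image_cong) auto
  also have "\<dots> = (!) l ` {..<N}"
  proof -
    have "(\<lambda>i. N - Suc i) ` {..<N} = {..<N}"
    proof (intro equalityI subsetI)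
      fix k assume "k \<in> {..<N}"
      then show "k \<in> (\<lambda>i. N - Suc i) ` {..<N}"
        by (intro image_eqI[of _ _ "N - Suc k"]) auto
    qed auto
    then show ?thesis by (metis image_image)
  qed
  also have "\<dots> = B" using l by (auto simp: set_conv_nth)
  finally have beta: "beta N xs = B" .
  then have "sum_list xs = m" using sum_beta[OF xs len] B by simp
  then show "\<exists>x\<in>{xs \<in> partitions. sum_list xs = m}. B = beta N x" using beta xs by blast
qed

section \<open>Logarithmic derivatives and the generating function\<close>

text \<open>\<open>L\<close> is q A' / A, stated without division.\<close>

definition log_deriv :: "complex fps \<Rightarrow> complex fps \<Rightarrow> bool" where
  "log_deriv A L \<longleftrightarrow> fps_X * fps_deriv A = A * L"

lemma log_deriv_mult: "log_deriv A L \<Longrightarrow> log_deriv A' L' \<Longrightarrow> log_deriv (A * A') (L + L')"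
  unfolding log_deriv_def
proof -
  assume 1: "fps_X * fps_deriv A = A * L" and 2: "fps_X * fps_deriv A' = A' * L'"
  have "fps_X * fps_deriv (A * A') = A * (fps_X * fps_deriv A') + (fps_X * fps_deriv A) * A'"
    by (simp add: algebra_simps)
  then show "fps_X * fps_deriv (A * A') = A * A' * (L + L')"
    unfolding 1 2 by (simp add: algebra_simps)
qed

lemma log_deriv_1: "log_deriv 1 0"
  by (simp add: log_deriv_def)

lemma log_deriv_prod:
  assumes "\<And>x. x \<in> I \<Longrightarrow> log_deriv (A x) (L x)"
  shows "log_deriv (prod A I) (sum L I)"
  using assms
  by (induction I rule: infinite_finite_induct) (auto intro: log_deriv_mult log_deriv_1)

lemma log_deriv_power: "log_deriv A L \<Longrightarrow> log_deriv (A ^ r) (of_nat r * L)"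
  using log_deriv_prod[of "{..<r}" "\<lambda>_. A" "\<lambda>_. L"] by simp

lemma log_deriv_exp: "log_deriv (fps_exp 1 oo S) (fps_X * fps_deriv S)" if "fps_nth S 0 = 0"
  using that by (simp add: log_deriv_def fps_compose_deriv fps_exp_deriv mult_ac)

text \<open>For \<open>a \<ge> 1\<close> the expansion of c q^a / (1 - c q^a).\<close>

definition geo_series :: "complex \<Rightarrow> nat \<Rightarrow> complex fps" where
  "geo_series c a = Abs_fps (\<lambda>l. if l \<noteq> 0 \<and> a dvd l then c ^ (l div a) else 0)"

lemma geo_series_mult:
  assumes "a \<ge> 1"
  shows "(1 - fps_const c * fps_X ^ a) * geo_series c a = fps_const c * fps_X ^ a"
proof (rule fps_ext)
  fix l
  have "fps_nth ((1 - fps_const c * fps_X ^ a) * geo_series c a) l =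
      fps_nth (geo_series c a) l - c * (if l < a then 0 else fps_nth (geo_series c a) (l - a))"
    by (simp add: left_diff_distrib mult.assoc fps_X_power_mult_nth)
  also have "\<dots> = (if l = a then c else 0)"
  proof (cases "a dvd l")
    case True
    then obtain q where q: "l = a * q" by auto
    show ?thesis
    proof (cases q)
      case (Suc q')
      then have "l - a = a * q'" "\<not> l < a" using q by auto
      then show ?thesis using q Suc assms by (cases q') (auto simp: geo_series_def)
    qed (use assms q in \<open>auto simp: geo_series_def\<close>)
  next
    case False
    then have "\<not> l < a \<Longrightarrow> \<not> a dvd l - a" by (simp add: dvd_minus_self)
    then show ?thesis using False by (auto simp: geo_series_def)
  qed
  also have "\<dots> = fps_nth (fps_const c * fps_X ^ a) l" by simp
  finally show "fps_nth ((1 - fps_const c * fps_X ^ a) * geo_series c a) l = fps_nth (fps_const c * fps_X ^ a) l" .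
qed

lemma log_deriv_factor:
  assumes "a \<ge> 1"
  shows "log_deriv (1 - fps_const c * fps_X ^ a) (- of_nat a * geo_series c a)"
proof -
  have "fps_X * fps_deriv (1 - fps_const c * fps_X ^ a) = - of_nat a * (fps_const c * fps_X ^ a)"
  proof -
    have "fps_X * fps_X ^ (a - 1) = (fps_X ^ a :: complex fps)"
      using assms by (simp flip: power_Suc)
    then show ?thesis
      by (simp add: fps_deriv_power fps_of_nat[symmetric] mult_ac del: power_Suc)
  qed
  also have "\<dots> = - of_nat a * ((1 - fps_const c * fps_X ^ a) * geo_series c a)"
    by (simp only: geo_series_mult[OF assms])
  finally show ?thesis by (simp add: log_deriv_def mult_ac)
qed

lemma log_deriv_nth:
  assumes "log_deriv A L"
  shows "of_nat k * fps_nth A k = (\<Sum>i\<le>k. fps_nth A i * fps_nth L (k - i))"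
proof -
  have "fps_nth (fps_X * fps_deriv A) k = of_nat k * fps_nth A k"
    by (cases k) simp_all
  then have "of_nat k * fps_nth A k = fps_nth (A * L) k"
    using assms by (simp only: log_deriv_def)
  then show ?thesis by (simp add: fps_mult_nth atLeast0AtMost)
qed

text \<open>As \<open>L\<close> has no constant term, each coefficient depends on lower ones only: a
  series is determined by its constant term and its logarithmic derivative.\<close>

lemma log_deriv_nth':
  assumes "log_deriv A L" "fps_nth L 0 = 0" "k > 0"
  shows "fps_nth A k = (\<Sum>i<k. fps_nth A i * fps_nth L (k - i)) / of_nat k"
  using log_deriv_nth[OF assms(1), of k] assms(2,3)
  by (simp add: field_simps lessThan_Suc_atMost[symmetric])

lemma log_deriv_agree:
  assumes "log_deriv A L" "log_deriv A' L'" "fps_nth A 0 = fps_nth A' 0"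
    "fps_nth L 0 = 0" "agree m L L'"
  shows "agree m A A'"
proof -
  have L0: "fps_nth L' 0 = 0" using assms(4,5) by (auto simp: agree_def)
  have "fps_nth A k = fps_nth A' k" if "k \<le> m" for k
    using that
  proof (induction k rule: less_induct)
    case (less k)
    show ?case
    proof (cases "k = 0")
      case False
      have "(\<Sum>i<k. fps_nth A i * fps_nth L (k - i)) = (\<Sum>i<k. fps_nth A' i * fps_nth L' (k - i))"
        using less assms(5) by (intro sum.cong arg_cong2[where f = "(*)"]) (auto simp: agree_def)
      then show ?thesis
        using log_deriv_nth'[OF assms(1,4)] log_deriv_nth'[OF assms(2) L0] False by simp
    qed (use assms in simp)
  qed
  then show ?thesis by (simp add: agree_def)
qed

lemma fps_prod_nth_0: "fps_nth (prod f A) 0 = (\<Prod>x\<in>A. fps_nth (f x) 0)"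
  for f :: "'a \<Rightarrow> complex fps"
  by (induction A rule: infinite_finite_induct) auto

section \<open>Generating functions of partitions and of hook products\<close>

definition partitions_of :: "nat \<Rightarrow> nat list set" where
  "partitions_of m = {xs \<in> partitions. sum_list xs = m}"

lemma card_exact_sets: "m \<le> N \<Longrightarrow> card (exact_sets N m) = card (partitions_of m)"
  using bij_betw_same_card[OF bij_betw_beta, of m N] by (simp add: partitions_of_def)

lemma finite_partitions_of [simp]: "finite (partitions_of m)"
proof -
  have "exact_sets m m \<subseteq> low_sets m m" by (auto simp: exact_sets_def low_sets_def)
  then have "finite (exact_sets m m)" by (rule finite_subset) simp
  then show ?thesis
    using bij_betw_finite[OF bij_betw_beta[of m m]] by (simp add: partitions_of_def)
qed

definition partition_series :: "complex fps" where
  "partition_series = Abs_fps (\<lambda>m. of_nat (card (partitions_of m)))"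

text \<open>The last box of the last row has neither arm nor leg.\<close>

lemma exists_hook_1:
  assumes "xs \<in> partitions" "xs \<noteq> []"
  shows "\<exists>c\<in>ferrers xs. card (hook xs c) = 1"
proof -
  define i where "i = length xs - 1"
  define j where "j = xs ! i - 1"
  have i: "Suc i = length xs" using assms by (simp add: i_def)
  have "xs ! i \<noteq> 0" using assms i by (metis lessI mem_Collect_eq nth_mem partitions_def)
  then have j: "part xs i = Suc j" using i by (simp add: part_def j_def)
  have "card (hook xs (i, j)) = 1"
    using conj_part_le_length[OF assms(1), of j] i j by (subst card_hook[OF assms(1)]) auto
  then show ?thesis using j by (intro bexI[of _ "(i, j)"]) (auto simp: ferrers_part)
qed

lemma finite_ferrers [simp]: "finite (ferrers xs)"
proof -
  have "ferrers xs = (SIGMA i:{..<length xs}. {..<xs ! i})" by (auto simp: ferrers_def)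
  then show ?thesis by simp
qed

context generic_base begin

definition hook_sum :: "nat \<Rightarrow> complex \<Rightarrow> nat \<Rightarrow> complex" where
  "hook_sum r u m = (\<Sum>xs\<in>partitions_of m. \<Prod>c\<in>ferrers xs. hook_weight r p u (card (hook xs c)))"

text \<open>Through beta numbers the hook products become minors, so \<open>sum_minors_core\<close>
  applies. \<open>N\<close> is chosen large enough for the column operations and for the
  bijection.\<close>

lemma hook_sum_core:
  assumes r: "r \<ge> 1"
  shows "hook_sum r (p ^ n) m = fps_nth (core_factor r n m * partition_series) m"
proof -
  define N where "N = m + r * Suc n"
  have N: "m \<le> N" "m + r * Suc n \<le> N" by (auto simp: N_def)
  have "hook_sum r (p ^ n) m = (\<Sum>xs\<in>partitions_of m. minor (beta N xs) (fock_kernel r p (p ^ n)))"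
    unfolding hook_sum_def
  proof (rule sum.cong[OF refl])
    fix xs assume "xs \<in> partitions_of m"
    then have xs: "xs \<in> partitions" "length xs \<le> N"
      using length_le_sum_list[of xs] N by (auto simp: partitions_of_def)
    show "(\<Prod>c\<in>ferrers xs. hook_weight r p (p ^ n) (card (hook xs c))) = minor (beta N xs) (fock_kernel r p (p ^ n))"
      using p0 by (simp add: fock_kernel_minor[OF r _ finite_beta[OF xs]] prod_hooks_beta[OF xs])
  qed
  also have "\<dots> = (\<Sum>B\<in>exact_sets N m. minor B (fock_kernel r p (p ^ n)))"
    using bij_betw_beta[OF N(1)] by (intro sum.reindex_bij_betw) (simp add: partitions_of_def)
  also have "\<dots> = (\<Sum>k\<le>m. fps_nth (core_factor r n m) k * of_nat (card (exact_sets N (m - k))))"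
    by (rule sum_minors_core[OF r N(2)])
  also have "\<dots> = fps_nth (core_factor r n m * partition_series) m"
    using N(1) by (simp add: fps_mult_nth atLeast0AtMost partition_series_def card_exact_sets)
  finally show ?thesis .
qed

text \<open>For \<open>r = 1\<close> and \<open>u = p\<close> every nonempty partition has weight zero, since it has a hook of
  length one. So the trace formula itself yields the generating function of all partitions.\<close>

lemma partition_series_inverse:
  "agree m ((\<Prod>s\<in>{1..m}. 1 - fps_X ^ s) * partition_series) 1"
proof -
  have "fps_nth (core_factor 1 1 m * partition_series) k = of_bool (k = 0)" if "k \<le> m" for k
  proof -
    have "fps_nth (core_factor 1 1 m * partition_series) k = fps_nth (core_factor 1 1 k * partition_series) k"
      using core_factor_agree[of 1 k m 1] that by (intro agreeD[of k] agree_mult) auto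
    also have "\<dots> = hook_sum 1 p k" using hook_sum_core[of 1 1 k] by simp
    also have "\<dots> = of_bool (k = 0)"
    proof (cases "k = 0")
      case True
      have "xs = []" if "xs \<in> partitions_of 0" for xs
      proof -
        have "xs \<in> partitions" "sum_list xs = 0" using that unfolding partitions_of_def by auto
        then have "length xs \<le> 0" using length_le_sum_list[of xs] by linarith
        then show ?thesis by simp
      qed
      then have "partitions_of 0 = {[]}" by (auto simp: partitions_of_def partitions_def)
      then show ?thesis using True by (simp add: hook_sum_def ferrers_def)
    next
      case False
      have "(\<Prod>c\<in>ferrers xs. hook_weight 1 p p (card (hook xs c))) = 0" if "xs \<in> partitions_of k" for xs
      proof -
        have "xs \<in> partitions" "xs \<noteq> []" using that False by (auto simp: partitions_of_def)
        then obtain c where "c \<in> ferrers xs" "card (hook xs c) = 1" using exists_hook_1 by blast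
        then show ?thesis using p0 by (intro prod_zero) (auto simp: hook_weight_def intro!: bexI[of _ c])
      qed
      then have "hook_sum 1 p k = 0" unfolding hook_sum_def by (intro sum.neutral) blast
      then show ?thesis using False by simp
    qed
    finally show ?thesis .
  qed
  moreover have "core_factor 1 1 m = (\<Prod>s\<in>{1..m}. 1 - fps_X ^ s)"
    using p0 by (simp add: core_factor_def)
  ultimately show ?thesis by (simp add: agree_def)
qed

section \<open>Comparison with the exponential\<close>

definition sin_ratio :: "complex \<Rightarrow> nat \<Rightarrow> complex" where
  "sin_ratio u k = (2 - u ^ k - (1 / u) ^ k) / (2 - p ^ k - (1 / p) ^ k)"

text \<open>The exponent with its geometric series expanded. The range \<open>{1..l}\<close>
  contains all relevant \<open>k\<close> when \<open>l > 0\<close> and makes the constant term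
  0.\<close>

definition log_series :: "nat \<Rightarrow> complex \<Rightarrow> complex fps" where
  "log_series r u = Abs_fps (\<lambda>l. (\<Sum>k | k \<in> {1..l} \<and> k dvd l. 1 / of_nat k) -
    (\<Sum>k | k \<in> {1..l} \<and> r * k dvd l. of_nat r / of_nat k * sin_ratio u k))"

lemma log_series_0: "fps_nth (log_series r u) 0 = 0"
  by (simp add: log_series_def)

text \<open>The quotient is a product of two geometric sums, in p^k and in p^(-k).\<close>

lemma sin_ratio_power:
  assumes "k \<ge> 1"
  shows "sin_ratio (p ^ n) k = (\<Sum>j<n. \<Sum>i<n. (p ^ i / p ^ j) ^ k)"
proof -
  define P where "P = p ^ k"
  have P: "P \<noteq> 0" "P \<noteq> 1" using p0 p1[OF assms] by (auto simp: P_def)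
  have PP: "1 / P \<noteq> 1" using P by auto
  have "(\<Sum>j<n. \<Sum>i<n. (p ^ i / p ^ j) ^ k) = (\<Sum>j<n. \<Sum>i<n. P ^ i * (1 / P) ^ j)"
    by (intro sum.cong refl) (simp add: P_def power_divide mult.commute flip: power_mult)
  also have "\<dots> = (\<Sum>i<n. P ^ i) * (\<Sum>j<n. (1 / P) ^ j)"
    by (simp add: sum_distrib_left sum_distrib_right mult_ac)
  also have "\<dots> = ((P ^ n - 1) / (P - 1)) * (((1 / P) ^ n - 1) / (1 / P - 1))"
    unfolding geometric_sum[OF P(2)] geometric_sum[OF PP] ..
  also have "\<dots> = ((P ^ n - 1) * ((1 / P) ^ n - 1)) / ((P - 1) * (1 / P - 1))"
    by simp
  also have "(P ^ n - 1) * ((1 / P) ^ n - 1) = 2 - P ^ n - (1 / P) ^ n"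
  proof -
    have "P ^ n * (1 / P) ^ n = 1" using P by (simp flip: power_mult_distrib)
    then show ?thesis by (simp add: left_diff_distrib right_diff_distrib)
  qed
  also have "(P - 1) * (1 / P - 1) = 2 - P - 1 / P"
  proof -
    have "P * (1 / P) = 1" using P by simp
    then show ?thesis by (simp only: left_diff_distrib right_diff_distrib) simp
  qed
  finally show ?thesis
    by (simp add: sin_ratio_def P_def power_one_over mult.commute flip: power_mult)
qed

text \<open>Replace \<open>k\<close> by the complementary divisor \<open>s = l / (r k)\<close>, so
  that \<open>l / k = r s\<close>; the weights 1 / k become the exponents of the factors in the
  product.\<close>

lemma log_series_deriv_nth:
  assumes r: "r \<ge> 1" and l: "1 \<le> l" "l \<le> m"
  shows "fps_nth (fps_X * fps_deriv (log_series r (p ^ n))) l =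
    (\<Sum>s\<in>{1..m}. of_nat s * fps_nth (geo_series 1 s) l) -
    (\<Sum>s\<in>{1..m}. \<Sum>j<n. \<Sum>i<n. of_nat r * of_nat (r * s) * fps_nth (geo_series (p ^ i / p ^ j) (r * s)) l)"
proof -
  \<comment> \<open>Quantified over its own \<open>r\<close>, because the first sum needs the case
    \<open>r = 1\<close>.\<close>
  have codiv: "l div (r * (l div (r * k))) = k" "1 \<le> l div (r * k)" "l div (r * k) \<le> l"
      "r * (l div (r * k)) dvd l" "of_nat (r * (l div (r * k))) = (of_nat l / of_nat k :: complex)"
    if rk: "r \<ge> 1" "r * k dvd l" for r k
  proof -
    obtain q where q: "l = r * k * q" using rk(2) by (rule dvdE)
    have nz: "r \<noteq> 0" "k \<noteq> 0" "q \<noteq> 0" using rk l q by (auto intro!: Nat.gr0I)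
    then have "l div (r * k) = q" by (simp add: q)
    moreover have "l div (r * q) = k" using nz by (simp add: q)
    ultimately show "l div (r * (l div (r * k))) = k" "1 \<le> l div (r * k)" "l div (r * k) \<le> l"
      "r * (l div (r * k)) dvd l" "of_nat (r * (l div (r * k))) = (of_nat l / of_nat k :: complex)"
      using nz by (auto simp: q)
  qed
  have "fps_nth (fps_X * fps_deriv (log_series r (p ^ n))) l = of_nat l * fps_nth (log_series r (p ^ n)) l"
    using l by (cases l) auto
  also have "\<dots> = (\<Sum>k | k \<in> {1..l} \<and> k dvd l. of_nat l / of_nat k) -
    (\<Sum>k | k \<in> {1..l} \<and> r * k dvd l. of_nat r * (of_nat l / of_nat k) * sin_ratio (p ^ n) k)"
    by (simp add: log_series_def right_diff_distrib sum_distrib_left mult_ac)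
  also have "(\<Sum>k | k \<in> {1..l} \<and> k dvd l. of_nat l / of_nat k :: complex) = (\<Sum>s | s \<in> {1..m} \<and> s dvd l. of_nat s)"
    by (rule sum.reindex_bij_witness[of _ "\<lambda>s. l div (1 * s)" "\<lambda>k. l div (1 * k)"])
      (use codiv[of 1] l in \<open>auto intro: le_trans[OF div_le_dividend]\<close>)
  also have "\<dots> = (\<Sum>s\<in>{1..m}. of_nat s * fps_nth (geo_series 1 s) l)"
    using l by (intro sum.mono_neutral_cong_left) (auto simp: geo_series_def)
  also have "(\<Sum>k | k \<in> {1..l} \<and> r * k dvd l. of_nat r * (of_nat l / of_nat k) * sin_ratio (p ^ n) k) =
    (\<Sum>s | s \<in> {1..m} \<and> r * s dvd l. of_nat r * of_nat (r * s) * sin_ratio (p ^ n) (l div (r * s)))"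
    by (rule sum.reindex_bij_witness[of _ "\<lambda>s. l div (r * s)" "\<lambda>k. l div (r * k)"])
      (use codiv[OF r] l in \<open>auto simp del: of_nat_mult intro: le_trans[OF div_le_dividend]\<close>)
  also have "\<dots> = (\<Sum>s\<in>{1..m}. \<Sum>j<n. \<Sum>i<n. of_nat r * of_nat (r * s) * fps_nth (geo_series (p ^ i / p ^ j) (r * s)) l)"
  proof (rule sum.mono_neutral_cong_left)
    fix s assume "s \<in> {s. s \<in> {1..m} \<and> r * s dvd l}"
    then have "l div (r * s) \<ge> 1" "r * s dvd l"
      using l by (auto elim!: dvdE)
    then show "of_nat r * of_nat (r * s) * sin_ratio (p ^ n) (l div (r * s)) =
      (\<Sum>j<n. \<Sum>i<n. of_nat r * of_nat (r * s) * fps_nth (geo_series (p ^ i / p ^ j) (r * s)) l)"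
      using l by (simp add: sin_ratio_power geo_series_def sum_distrib_left)
  qed (auto simp: geo_series_def)
  finally show ?thesis .
qed

text \<open>By \<open>hook_sum_core\<close> the exponential must equal \<open>core_factor\<close>
  times \<open>partition_series\<close>. Multiplied by \<open>?B\<close>, which inverts the latter
  to the required order, this follows from equal logarithmic derivatives.\<close>

lemma hook_sum_power:
  assumes r: "r \<ge> 1"
  shows "hook_sum r (p ^ n) m = fps_nth (fps_exp 1 oo log_series r (p ^ n)) m"
proof -
  let ?R = "fps_exp 1 oo log_series r (p ^ n)" and ?B = "\<Prod>s\<in>{1..m}. 1 - fps_X ^ s :: complex fps"
  let ?LB = "\<Sum>s\<in>{1..m}. - of_nat s * geo_series 1 s"
  let ?LC = "\<Sum>s\<in>{1..m}. \<Sum>j<n. of_nat r * (\<Sum>i<n. - of_nat (r * s) * geo_series (p ^ i / p ^ j) (r * s))"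
  have B: "log_deriv ?B ?LB"
  proof (rule log_deriv_prod)
    fix s assume "s \<in> {1..m}"
    then show "log_deriv (1 - fps_X ^ s) (- of_nat s * geo_series 1 s)"
      using log_deriv_factor[of s 1] by simp
  qed
  have C: "log_deriv (core_factor r n m) ?LC"
    unfolding core_factor_def using r
    by (intro log_deriv_prod log_deriv_power log_deriv_factor) auto
  have RB: "log_deriv (?R * ?B) (fps_X * fps_deriv (log_series r (p ^ n)) + ?LB)"
    by (intro log_deriv_mult log_deriv_exp log_series_0 B)
  have "agree m (?R * ?B) (core_factor r n m)"
  proof (rule log_deriv_agree[OF RB C])
    show "fps_nth (?R * ?B) 0 = fps_nth (core_factor r n m) 0"
      using r by (simp add: core_factor_def fps_prod_nth_0 fps_power_zeroth power_0_left)
    show "fps_nth (fps_X * fps_deriv (log_series r (p ^ n)) + ?LB) 0 = 0"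
      by (simp add: fps_sum_nth geo_series_def)
    show "agree m (fps_X * fps_deriv (log_series r (p ^ n)) + ?LB) ?LC"
      unfolding agree_def
    proof (intro allI impI)
      fix l assume lm: "l \<le> m"
      have scale: "fps_nth (of_nat c * f) k = of_nat c * fps_nth f k" for c k and f :: "complex fps"
        by (simp add: fps_of_nat[symmetric])
      show "fps_nth (fps_X * fps_deriv (log_series r (p ^ n)) + ?LB) l = fps_nth ?LC l"
      proof (cases "l = 0")
        case True
        then show ?thesis by (simp add: fps_sum_nth geo_series_def)
      next
        case False
        then have "1 \<le> l" by simp
        note * = log_series_deriv_nth[OF r this lm, of n]
        show ?thesis
          unfolding fps_add_nth * 
          by (simp add: fps_sum_nth scale sum_negf sum_distrib_left mult.assoc del: of_nat_mult)
      qed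
    qed
  qed
  then have "agree m (?R * ?B * partition_series) (core_factor r n m * partition_series)"
    by (intro agree_mult agree_refl)
  moreover have "agree m (?R * (?B * partition_series)) (?R * 1)"
    by (intro agree_mult agree_refl partition_series_inverse)
  ultimately show ?thesis
    unfolding hook_sum_core[OF r] by (simp add: agree_def mult.assoc)
qed

text \<open>The recursion \<open>log_deriv_nth'\<close> expresses each coefficient through lower
  ones and those of the exponent.\<close>

lemma laurent_exp_log_series: "laurent (\<lambda>u. fps_nth (fps_exp 1 oo log_series r u) m)"
proof (induction m rule: less_induct)
  case (less m)
  have S: "laurent (\<lambda>u. fps_nth (log_series r u) l)" for l
    unfolding log_series_def sin_ratio_def fps_nth_Abs_fps
    by (intro laurent_diff laurent_sum laurent_mult laurent_divide_const laurent_const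
      laurent_power laurent_ident laurent_inverse)
  show ?case
  proof (cases "m = 0")
    case False
    have "fps_nth (fps_exp 1 oo log_series r u) m =
        (\<Sum>i<m. fps_nth (fps_exp 1 oo log_series r u) i * (of_nat (m - i) * fps_nth (log_series r u) (m - i))) / of_nat m" for u
    proof -
      have nth: "fps_nth (fps_X * fps_deriv (log_series r u)) k = of_nat k * fps_nth (log_series r u) k" for k
        by (cases k) simp_all
      have "fps_nth (fps_X * fps_deriv (log_series r u)) 0 = 0" "m > 0" using False by simp_all
      from log_deriv_nth'[OF log_deriv_exp[OF log_series_0] this] show ?thesis
        unfolding nth .
    qed
    then show ?thesis
      using less S by (auto simp only: lessThan_iff intro!: laurent_divide_const laurent_sum laurent_mult laurent_const)
  qed (simp add: laurent_const)
qed

text \<open>Both sides are Laurent polynomials in \<open>u\<close> that agree at the powers of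
  \<open>p\<close>, which are pairwise distinct since \<open>p\<close> is not a root of
  unity.\<close>

theorem hook_sum_eq:
  assumes r: "r \<ge> 1" and u: "u \<noteq> 0"
  shows "hook_sum r u m = fps_nth (fps_exp 1 oo log_series r u) m"
proof (rule laurent_eqI[where v = u])
  show "laurent (\<lambda>u. hook_sum r u m)"
    unfolding hook_sum_def by (intro laurent_sum laurent_prod laurent_hook_weight)
  show "laurent (\<lambda>u. fps_nth (fps_exp 1 oo log_series r u) m)"
    by (rule laurent_exp_log_series)
  have "inj ((^) p)"
  proof (rule linorder_injI)
    fix i j :: nat assume "i < j"
    show "p ^ i \<noteq> p ^ j"
    proof
      assume "p ^ i = p ^ j"
      also have "p ^ j = p ^ i * p ^ (j - i)" using \<open>i < j\<close> by (simp flip: power_add)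
      finally have "p ^ (j - i) = 1" using p0 by simp
      then show False using p1[of "j - i"] \<open>i < j\<close> by simp
    qed
  qed
  then have "infinite (range ((^) p))" by (rule range_inj_infinite)
  moreover have "range ((^) p) \<subseteq> {u. u \<noteq> 0 \<and> hook_sum r u m = fps_nth (fps_exp 1 oo log_series r u) m}"
    using p0 hook_sum_power[OF r] by auto
  ultimately show "infinite {u. u \<noteq> 0 \<and> hook_sum r u m = fps_nth (fps_exp 1 oo log_series r u) m}"
    using finite_subset by blast
qed (fact u)

end

section \<open>The trigonometric form\<close>

lemma fps_X_power_div_geometric:
  assumes "a \<ge> 1" "k \<ge> 1"
  shows "c * fps_X ^ a / (of_nat k * (1 - fps_X ^ a)) = c * fps_const (1 / of_nat k) * geo_series 1 a"
proof -
  let ?D = "of_nat k * (1 - fps_X ^ a) :: complex fps"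
  have "fps_nth ?D 0 = of_nat k" using assms by simp
  then have D: "?D \<noteq> 0" using assms by (metis fps_zero_nth not_one_le_zero of_nat_eq_0_iff)
  have k: "fps_const (1 / of_nat k) * of_nat k = (1 :: complex fps)"
    using assms by (simp flip: fps_of_nat)
  have "c * fps_X ^ a = c * ((1 - fps_X ^ a) * geo_series 1 a)"
    using geo_series_mult[OF assms(1), of 1] by simp
  also have "\<dots> = (fps_const (1 / of_nat k) * of_nat k) * (c * ((1 - fps_X ^ a) * geo_series 1 a))"
    by (simp only: k mult_1_left)
  also have "\<dots> = c * fps_const (1 / of_nat k) * geo_series 1 a * ?D"
    by (simp only: mult_ac)
  finally have "c * fps_X ^ a / ?D = c * fps_const (1 / of_nat k) * geo_series 1 a * ?D / ?D"
    by (simp only:)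
  then show ?thesis by (simp only: nonzero_mult_div_cancel_right[OF D])
qed

lemma sin_squared_exp: "(sin x)\<^sup>2 = (2 - exp (2 * \<i> * x) - 1 / exp (2 * \<i> * x)) / 4" for x :: complex
proof -
  have "exp (2 * \<i> * x) = exp (\<i> * x) * exp (\<i> * x)" by (simp only: mult_exp_exp) (simp add: algebra_simps)
  moreover have "exp (- (\<i> * x)) = 1 / exp (\<i> * x)" by (simp add: exp_minus divide_inverse)
  moreover have "exp (\<i> * x) \<noteq> 0" by simp
  ultimately show ?thesis
    by (simp add: sin_exp_eq power2_eq_square) (simp add: field_simps)
qed

lemma prod_hook_lengths_dvd:
  "(\<Prod>h\<in>#hook_lengths_dvd r xs. f h) =
    (\<Prod>c\<in>ferrers xs. if r dvd card (hook xs c) then f (card (hook xs c)) else 1)"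
  for f :: "nat \<Rightarrow> complex"
proof -
  have "(\<Prod>h\<in>#filter_mset (\<lambda>h. r dvd h) (image_mset g (mset_set F)). f h) =
      (\<Prod>c\<in>F. if r dvd g c then f (g c) else 1)" if "finite F" for g and F :: "(nat \<times> nat) set"
    using that by (induction F) auto
  then show ?thesis unfolding hook_lengths_dvd_def hook_lengths_def by simp
qed

lemma card_hook_pos: "c \<in> ferrers xs \<Longrightarrow> card (hook xs c) \<ge> 1"
proof -
  assume c: "c \<in> ferrers xs"
  then have "c \<in> hook xs c" by (simp add: hook_def)
  moreover have "finite (hook xs c)" by (rule finite_subset[of _ "ferrers xs"]) (auto simp: hook_def)
  ultimately show ?thesis by (metis One_nat_def Suc_leI card_gt_0_iff empty_iff)
qed

text \<open>Summability is asserted separately because \<open>suminf\<close> also has a value on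
  divergent series. The hypothesis on sines keeps every denominator nonzero.\<close>

theorem theorem2:
  fixes r :: nat and z t :: complex
  assumes "r \<ge> 1"
    and "\<And>k::nat. k \<ge> 1 \<Longrightarrow> sin (of_nat r * of_nat k * z) \<noteq> 0"
  shows "summable (\<lambda>k. log_term r z t (Suc k)) \<and>
    ((\<lambda>xs. fps_X ^ sum_list xs *
          fps_const (\<Prod>h\<in>#hook_lengths_dvd r xs. 1 - (sin (t * z))\<^sup>2 / (sin (of_nat h * z))\<^sup>2))
      has_sum fps_exponential (\<Sum>k. log_term r z t (Suc k))) partitions"
proof -
  define p where "p = exp (2 * \<i> * (of_nat r * z))"
  define u where "u = exp (2 * \<i> * (t * z))"
  have u: "u \<noteq> 0" and p0: "p \<noteq> 0" by (simp_all add: u_def p_def)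
  have p_power: "p ^ k = exp (2 * \<i> * (of_nat r * of_nat k * z))" for k
    by (simp add: p_def mult_ac flip: exp_of_nat_mult)
  have u_power: "u ^ k = exp (2 * \<i> * (t * of_nat k * z))" for k
    by (simp add: u_def mult_ac flip: exp_of_nat_mult)
  have sin_p: "(sin (of_nat r * of_nat k * z))\<^sup>2 = (2 - p ^ k - (1 / p) ^ k) / 4" for k
    unfolding sin_squared_exp p_power[symmetric] by (simp add: power_one_over)
  have sin_u: "(sin (t * of_nat k * z))\<^sup>2 = (2 - u ^ k - (1 / u) ^ k) / 4" for k
    unfolding sin_squared_exp u_power[symmetric] by (simp add: power_one_over)
  \<comment> \<open>If p^k were 1, then \<open>sin_p\<close> would make the sine at
    \<open>r k z\<close> vanish.\<close>
  interpret generic_base p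
  proof
    show "p ^ k \<noteq> 1" if "k \<ge> 1" for k
    proof
      assume "p ^ k = 1"
      then show False using sin_p[of k] assms(2)[OF that] by (simp add: power_one_over)
    qed
  qed (fact p0)
  have quarter: "x / 4 / (y / 4) = x / y" for x y :: complex by simp
  have ratio: "(sin (t * of_nat k * z))\<^sup>2 / (sin (of_nat r * of_nat k * z))\<^sup>2 = sin_ratio u k" for k
    unfolding sin_u sin_p sin_ratio_def by (rule quarter)
  \<comment> \<open>With P = p^k this rests on (1 - P)^2 + P (2 - u - 1/u) = (1 - u P) (1 -
    P/u).\<close>
  have weight: "(if r dvd h then 1 - (sin (t * z))\<^sup>2 / (sin (of_nat h * z))\<^sup>2 else 1) = hook_weight r p u h"
    if "h \<ge> 1" for h
  proof (cases "r dvd h")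
    case True
    then obtain k where h: "h = r * k" by auto
    then have k: "k \<ge> 1" "h div r = k" using that assms(1) by auto
    have nz: "p ^ k \<noteq> 0" "1 - p ^ k \<noteq> 0" using p0 p1[OF k(1)] by auto
    have pk: "2 - p ^ k - (1 / p) ^ k = - (1 - p ^ k)\<^sup>2 / p ^ k"
      using nz by (simp add: field_simps power2_eq_square power_one_over)
    have "(sin (t * z))\<^sup>2 / (sin (of_nat h * z))\<^sup>2 = (2 - u - 1 / u) / (2 - p ^ k - (1 / p) ^ k)"
    proof -
      have "(sin (t * z))\<^sup>2 = (2 - u - 1 / u) / 4" using sin_u[of 1] by simp
      moreover have "(sin (of_nat h * z))\<^sup>2 = (2 - p ^ k - (1 / p) ^ k) / 4"
        using sin_p[of k] by (simp add: h)
      ultimately show ?thesis by (simp only: quarter)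
    qed
    also have "\<dots> = - (p ^ k * (2 - u - 1 / u) / (1 - p ^ k)\<^sup>2)"
      unfolding pk by simp
    finally have "1 - (sin (t * z))\<^sup>2 / (sin (of_nat h * z))\<^sup>2 =
        ((1 - p ^ k)\<^sup>2 + p ^ k * (2 - u - 1 / u)) / (1 - p ^ k)\<^sup>2"
      using nz by (simp add: add_divide_distrib)
    also have "(1 - p ^ k)\<^sup>2 + p ^ k * (2 - u - 1 / u) = (1 - u * p ^ k) * (1 - p ^ k / u)"
      using u by (simp add: field_simps power2_eq_square)
    finally show ?thesis using True k by (simp add: hook_weight_def)
  qed (simp add: hook_weight_def)
  have term_nth: "fps_nth (log_term r z t k) l =
      (if l \<noteq> 0 \<and> k dvd l then 1 / of_nat k else 0) -
      (if l \<noteq> 0 \<and> r * k dvd l then of_nat r / of_nat k * sin_ratio u k else 0)" if "k \<ge> 1" for k l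
  proof -
    have rk: "r * k \<ge> 1" using that assms(1) by simp
    have "log_term r z t k = fps_const (1 / of_nat k) * geo_series 1 k -
        of_nat r * fps_const (1 / of_nat k) * geo_series 1 (r * k) * fps_const (sin_ratio u k)"
      unfolding log_term_def ratio fps_X_power_div_geometric[OF rk that]
      using fps_X_power_div_geometric[OF that that, of 1] by simp
    then show ?thesis by (simp add: geo_series_def flip: fps_of_nat)
  qed
  have sums: "(\<lambda>k. log_term r z t (Suc k)) sums log_series r u"
    unfolding sums_def
  proof (rule tendsto_fpsI)
    fix l
    \<comment> \<open>Terms with \<open>k > l\<close> do not reach degree \<open>l\<close>, so this
      coefficient is stationary from \<open>K = l\<close> on.\<close>
    show "\<forall>\<^sub>F K in sequentially. fps_nth (\<Sum>k<K. log_term r z t (Suc k)) l = fps_nth (log_series r u) l"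
      using eventually_ge_at_top[of l]
    proof eventually_elim
      case (elim K)
      have "fps_nth (\<Sum>k<K. log_term r z t (Suc k)) l = (\<Sum>k\<in>{1..K}. fps_nth (log_term r z t k) l)"
        unfolding fps_sum_nth by (rule sum.reindex_bij_witness[of _ "\<lambda>k. k - 1" Suc]) auto
      also have "\<dots> = (\<Sum>k\<in>{1..K}. if l \<noteq> 0 \<and> k dvd l then 1 / of_nat k else 0) -
          (\<Sum>k\<in>{1..K}. if l \<noteq> 0 \<and> r * k dvd l then of_nat r / of_nat k * sin_ratio u k else 0)"
        by (simp add: term_nth sum_subtractf)
      also have "(\<Sum>k\<in>{1..K}. if l \<noteq> 0 \<and> k dvd l then 1 / of_nat k else 0) =
          (\<Sum>k | k \<in> {1..l} \<and> k dvd l. 1 / of_nat k :: complex)"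
        using elim by (intro sum.mono_neutral_cong_right) (auto dest: dvd_imp_le)
      also have "(\<Sum>k\<in>{1..K}. if l \<noteq> 0 \<and> r * k dvd l then of_nat r / of_nat k * sin_ratio u k else 0) =
          (\<Sum>k | k \<in> {1..l} \<and> r * k dvd l. of_nat r / of_nat k * sin_ratio u k)"
        using elim by (intro sum.mono_neutral_cong_right) (auto dest: dvd_mult_right intro!: dvd_imp_le)
      finally show ?case by (simp add: log_series_def)
    qed
  qed
  have "((\<lambda>xs. fps_X ^ sum_list xs *
      fps_const (\<Prod>h\<in>#hook_lengths_dvd r xs. 1 - (sin (t * z))\<^sup>2 / (sin (of_nat h * z))\<^sup>2))
    has_sum fps_exponential (log_series r u)) partitions"
    unfolding has_sum_def
  proof (rule tendsto_fpsI)
    fix m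
    let ?w = "\<lambda>xs. \<Prod>h\<in>#hook_lengths_dvd r xs. 1 - (sin (t * z))\<^sup>2 / (sin (of_nat h * z))\<^sup>2"
    have w: "?w xs = (\<Prod>c\<in>ferrers xs. hook_weight r p u (card (hook xs c)))" for xs
      unfolding prod_hook_lengths_dvd by (intro prod.cong refl weight card_hook_pos)
    \<comment> \<open>Convergence is coefficientwise: every finite set containing all partitions of
      \<open>m\<close> already has the final coefficient of \<open>q^m\<close>.\<close>
    have "fps_nth (\<Sum>xs\<in>Y. fps_X ^ sum_list xs * fps_const (?w xs)) m = fps_nth (fps_exponential (log_series r u)) m"
      if Y: "finite Y" "partitions_of m \<subseteq> Y" "Y \<subseteq> partitions" for Y
    proof -
      have "fps_nth (\<Sum>xs\<in>Y. fps_X ^ sum_list xs * fps_const (?w xs)) m = (\<Sum>xs\<in>Y. if sum_list xs = m then ?w xs else 0)"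
        unfolding fps_sum_nth by (intro sum.cong refl) (auto simp: fps_X_power_mult_nth)
      also have "\<dots> = (\<Sum>xs\<in>partitions_of m. ?w xs)"
        using Y by (intro sum.mono_neutral_cong_right) (auto simp: partitions_of_def)
      also have "\<dots> = hook_sum r u m" unfolding w hook_sum_def ..
      finally show ?thesis by (simp add: hook_sum_eq[OF assms(1) u])
    qed
    then show "\<forall>\<^sub>F Y in finite_subsets_at_top partitions.
        fps_nth (\<Sum>xs\<in>Y. fps_X ^ sum_list xs * fps_const (?w xs)) m = fps_nth (fps_exponential (log_series r u)) m"
      unfolding eventually_finite_subsets_at_top
      using finite_partitions_of[of m] by (intro exI[of _ "partitions_of m"]) (auto simp: partitions_of_def)
  qed
  then show ?thesis
    using sums by (simp add: sums_iff)
qed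

end
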